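(* Let $m\ge 1$ worker nodes be given, and for $i\in\{1,\dots,m\}$ let $\mathcal{D}_i$ be a data distribution and $F_i(\bm{x}) := \mathbb{E}_{\bm{s}\sim\mathcal{D}_i}[\ell(\bm{x};\bm{s})]$ for $\bm{x}\in\mathbb{R}^d$, and set $F(\bm{x}) := \frac{1}{m}\sum_{i=1}^m F_i(\bm{x})$. Assume that $F$ is bounded below, with $F_{\inf} := \inf_{\bm{x}} F(\bm{x}) > -\infty$, and that: (1) each $F_i$ is $L$-smooth: $\|\nabla F_i(\bm{x})-\nabla F_i(\bm{y})\|\le L\|\bm{x}-\bm{y}\|$ for all $\bm{x},\bm{y}$ and all $i$; (2) the stochastic gradients are unbiased: $\mathbb{E}_{\xi\sim\mathcal{D}_i}[g_i(\bm{x};\xi)]=\nabla F_i(\bm{x})$; (3) $\mathbb{E}_{\xi\sim\mathcal{D}_i}[\|g_i(\bm{x};\xi)-\nabla F_i(\bm{x})\|^2]\le\sigma^2$ for all $\bm{x}$ and $i$; (4) $\frac{1}{m}\sum_{i=1}^m\|\nabla F_i(\bm{x})-\nabla F(\bm{x})\|^2\le\kappa^2$ for all $\bm{x}$. Fix an integer $\tau\ge1$, a parameter $\alpha\in(0,1)$, a total number of iterations $K$, and a learning rate $\gamma>0$. Consider the Overlap-Local-SGD iteration: local models $\bm{x}_k^{(i)}\in\mathbb{R}^d$ and an anchor model $\bm{z}_k\in\mathbb{R}^d$, all initialized at the same point, $\bm{x}_0^{(i)}=\bm{z}_0$ for all $i$, and for $k\ge0$ $$\bm{x}^{(i)}_{k+\frac12}=\bm{x}^{(i)}_k-\gamma\,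 g_i(\bm{x}^{(i)}_k;\xi^{(i)}_k),$$ where $\xi_k^{(i)}\sim\mathcal{D}_i$ is a freshly sampled mini-batch, and $$\bm{x}^{(i)}_{k+1}=\begin{cases}\bm{x}^{(i)}_{k+\frac12}-\alpha\big(\bm{x}^{(i)}_{k+\frac12}-\bm{z}_k\big), & (k+1)\bmod\tau=0,\\ \bm{x}^{(i)}_{k+\frac12}, &\text{otherwise},\end{cases}\qquad \bm{z}_{k+1}=\begin{cases}\frac1m\sum_{i=1}^m\bm{x}^{(i)}_{k+1}, & (k+1)\bmod\tau=0,\\ \bm{z}_k, &\text{otherwise}.\end{cases}$$ Define $\bm{y}_k := \frac{1-\alpha}{m}\sum_{i=1}^m\bm{x}^{(i)}_k+\alpha\bm{z}_k$. If $\gamma=\frac1L\sqrt{\frac{m}{K}}$ and $K\ge 60\,m\tau^2/\alpha^2$, then $$\frac1K\sum_{k=0}^{K-1}\mathbb{E}\big[\|\nabla F(\bm{y}_k)\|^2\big]\le\frac{4L[F(\bm{y}_0)-F_{\inf}]}{(1-\alpha)\sqrt{mK}}+\frac{2(1-\alpha)\sigma^2}{\sqrt{mK}}+\frac{2m\sigma^2}{K}\left[\frac{2}{(2-\alpha)\alpha}\tau-1\right]+\frac{2m\tau^2\kappa^2}{\alpha^2K},$$ which is $\mathcal{O}\big(1/\sqrt{mK}\big)+\mathcal{O}(1/K)$.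
   Context: $\ell(\bm{x};\bm{s})$ is the loss of model parameters $\bm{x}\in\mathbb{R}^d$ on a data sample $\bm{s}$; $g_i(\bm{x};\xi)$ denotes the stochastic gradient of the loss at $\bm{x}$ evaluated on a mini-batch $\xi$ drawn from $\mathcal{D}_i$. $\|\cdot\|$ is the Euclidean norm. The expectation is over all the random mini-batches used by the algorithm. *)

theory Defs
  imports "HOL-Probability.Probability"
begin

definition F_loc :: "'b measure \<Rightarrow> ('a \<Rightarrow> 'b \<Rightarrow> real) \<Rightarrow> 'a \<Rightarrow> real" where
  "F_loc Di loss x = (\<integral>s. loss x s \<partial>Di)"

definition F_glob :: "nat \<Rightarrow> (nat \<Rightarrow> 'b measure) \<Rightarrow> ('a \<Rightarrow> 'b \<Rightarrow> real) \<Rightarrow> 'a \<Rightarrow> real" where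
  "F_glob m D loss x = (\<Sum>i<m. F_loc (D i) loss x) / real m"

definition gradF_glob :: "nat \<Rightarrow> (nat \<Rightarrow> 'a \<Rightarrow> 'a) \<Rightarrow> 'a \<Rightarrow> 'a::real_vector" where
  "gradF_glob m gradF x = (1 / real m) *\<^sub>R (\<Sum>i<m. gradF i x)"

text \<open>Overlap-Local-SGD: state after k iterations = (local models i \<mapsto> x_k^(i), anchor z_k),
  driven by the sample path xi k i = mini-batch of worker i at step k.\<close>
primrec ols :: "nat \<Rightarrow> nat \<Rightarrow> real \<Rightarrow> real \<Rightarrow> (nat \<Rightarrow> 'a \<Rightarrow> 'b \<Rightarrow> 'a) \<Rightarrow> 'a
    \<Rightarrow> (nat \<Rightarrow> nat \<Rightarrow> 'b) \<Rightarrow> nat \<Rightarrow> (nat \<Rightarrow> 'a::real_vector) \<times> 'a" where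
  "ols m \<tau> \<alpha> \<gamma> g x0 xi 0 = ((\<lambda>i. x0), x0)"
| "ols m \<tau> \<alpha> \<gamma> g x0 xi (Suc k) =
    (let X = fst (ols m \<tau> \<alpha> \<gamma> g x0 xi k);
         z = snd (ols m \<tau> \<alpha> \<gamma> g x0 xi k);
         H = (\<lambda>i. X i - \<gamma> *\<^sub>R g i (X i) (xi k i))
     in if Suc k mod \<tau> = 0
        then (let X' = (\<lambda>i. H i - \<alpha> *\<^sub>R (H i - z))
              in (X', (1 / real m) *\<^sub>R (\<Sum>i<m. X' i)))
        else (H, z))"

definition ols_y :: "nat \<Rightarrow> nat \<Rightarrow> real \<Rightarrow> real \<Rightarrow> (nat \<Rightarrow> 'a \<Rightarrow> 'b \<Rightarrow> 'a) \<Rightarrow> 'a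
    \<Rightarrow> (nat \<Rightarrow> nat \<Rightarrow> 'b) \<Rightarrow> nat \<Rightarrow> 'a::real_vector" where
  "ols_y m \<tau> \<alpha> \<gamma> g x0 xi k =
    ((1 - \<alpha>) / real m) *\<^sub>R (\<Sum>i<m. fst (ols m \<tau> \<alpha> \<gamma> g x0 xi k) i)
    + \<alpha> *\<^sub>R snd (ols m \<tau> \<alpha> \<gamma> g x0 xi k)"

end

theory Submission
  imports Defs
begin

text \<open>
  The virtual sequence obeys \<open>y\<^sub>k\<^sub>+\<^sub>1 = y\<^sub>k - (1 - \<alpha>) \<gamma> \<cdot> (mean stochastic gradient)\<close> at every step,
  synchronization or not, so the descent lemma applies to it and only the consensus error
  \<open>V\<^sub>k = mean \<parallel>x\<^sub>k\<^sup>i - y\<^sub>k\<parallel>\<^sup>2\<close> has to be controlled. It splits orthogonally into the dispersion of the local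
  models about their mean, which is multiplied by \<open>1 - \<alpha>\<close> at each synchronization, and \<open>\<alpha>\<close> times the
  gap between this mean and the anchor, which is reset to zero. Both are linear in the stochastic
  gradients, hence sums of a noise part and a drift part. The noise has orthogonal increments and
  contributes \<open>\<sigma>\<^sup>2 (\<tau> / ((2 - \<alpha>) \<alpha>) - 1)\<close>; the drift contributes \<open>\<kappa>\<^sup>2 (\<tau> / \<alpha>)\<^sup>2\<close>, a multiple of \<open>V\<close> that the
  step size makes small, and mean-gradient terms absorbed by the negative term of the descent
  lemma. The weights \<open>7/2\<close>, \<open>7/5\<close> and \<open>5/4\<close>, \<open>5\<close> of the Young inequalities are chosen such that the final
  constants \<open>210/53\<close> and \<open>105/53\<close> stay below \<open>4\<close> and \<open>2\<close>. The resulting inequality holds along every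
  sample path and contains \<open>F\<close> only through \<open>F y\<^sub>0\<close> and its lower bound, so integrability of \<open>F y\<^sub>k\<close> is
  never needed.
\<close>

section \<open>Damped sums and means over the workers\<close>

text \<open>The input \<open>a k\<close> is added before the factor of step \<open>k + 1\<close> is
  applied, just as a gradient step precedes the pull-back to the anchor. So \<open>a j\<close>
  enters the value at \<open>k\<close> with weight \<open>\<beta>\<close> to the number of multiples
  of \<open>\<tau>\<close> among \<open>j + 1, ..., k\<close>.\<close>

primrec damped :: "nat \<Rightarrow> real \<Rightarrow> (nat \<Rightarrow> 'a::real_vector) \<Rightarrow> nat \<Rightarrow> 'a" where
  "damped \<tau> \<beta> a 0 = 0"
| "damped \<tau> \<beta> a (Suc k) = (if Suc k mod \<tau> = 0 then \<beta> else 1) *\<^sub>R (damped \<tau> \<beta> a k + a k)"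

lemma damped_add: "damped \<tau> \<beta> (\<lambda>k. a k + b k) k = damped \<tau> \<beta> a k + damped \<tau> \<beta> b k"
  by (induction k) (simp_all add: algebra_simps)

lemma damped_scaleR: "damped \<tau> \<beta> (\<lambda>k. c *\<^sub>R a k) k = c *\<^sub>R damped \<tau> \<beta> a k"
  by (induction k) (simp_all add: algebra_simps)

lemma damped_cmult:
  fixes a :: "nat \<Rightarrow> real"
  shows "damped \<tau> \<beta> (\<lambda>k. c * a k) k = c * damped \<tau> \<beta> a k"
  using damped_scaleR[of \<tau> \<beta> c a k] by simp

lemma damped_sum: "damped \<tau> \<beta> (\<lambda>k. \<Sum>i\<in>I. a i k) k = (\<Sum>i\<in>I. damped \<tau> \<beta> (a i) k)"
  by (induction k) (simp_all add: sum.distrib scaleR_sum_right scaleR_add_right)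

lemma damped_nonneg:
  fixes a :: "nat \<Rightarrow> real"
  assumes "0 \<le> \<beta>" "\<And>k. 0 \<le> a k"
  shows "0 \<le> damped \<tau> \<beta> a n"
  by (induction n) (simp_all add: assms)

text \<open>The factor may grow as well, so that reset sums with factor 0 can later be compared with
  sums of factor \<open>(1 - \<alpha>)\<^sup>2\<close>.\<close>

lemma damped_mono:
  fixes a b :: "nat \<Rightarrow> real"
  assumes "0 \<le> \<beta>" "\<beta> \<le> \<beta>'" "\<And>k. 0 \<le> a k" "\<And>k. a k \<le> b k"
  shows "damped \<tau> \<beta> a n \<le> damped \<tau> \<beta>' b n"
proof (induction n)
  case (Suc k)
  then show ?case
    using damped_nonneg[where n = k and \<tau> = \<tau>, OF assms(1,3)] assms(1,2) assms(3)[of k] assms(4)[of k]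
    by (auto intro!: mult_mono add_mono)
qed simp

lemma norm_damped_le:
  assumes "0 \<le> \<beta>"
  shows "norm (damped \<tau> \<beta> a k) \<le> damped \<tau> \<beta> (\<lambda>k. norm (a k)) k"
proof (induction k)
  case (Suc k)
  have "norm (damped \<tau> \<beta> a k + a k) \<le> damped \<tau> \<beta> (\<lambda>k. norm (a k)) k + norm (a k)"
    using Suc norm_triangle_ineq[of "damped \<tau> \<beta> a k" "a k"] by linarith
  then show ?case
    using assms by (auto intro: mult_left_mono)
qed simp

text \<open>One full period maps \<open>s\<close> to \<open>\<beta> * (s + \<tau>)\<close>, with
  fixed point \<open>\<tau> * \<beta> / (1 - \<beta>)\<close>; starting from 0, the value after a
  synchronization never exceeds it. The steps since then add \<open>k mod \<tau>\<close>, at most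
  \<open>\<tau> - 1\<close>, whence the final \<open>- 1\<close>.\<close>

lemma damped_one_le:
  assumes "0 \<le> \<beta>" "\<beta> < 1" "1 \<le> \<tau>"
  shows "damped \<tau> \<beta> (\<lambda>_. 1) k \<le> real \<tau> / (1 - \<beta>) - 1"
proof -
  have "damped \<tau> \<beta> (\<lambda>_. 1) k \<le> real (k mod \<tau>) + \<tau> * \<beta> / (1 - \<beta>)"
  proof (induction k)
    case 0
    show ?case using assms by simp
  next
    case (Suc k)
    show ?case
    proof (cases "Suc (k mod \<tau>) = \<tau>")
      case True
      then have "damped \<tau> \<beta> (\<lambda>_. 1) k + 1 \<le> \<tau> + \<tau> * \<beta> / (1 - \<beta>)"
        using Suc by linarith
      also have "\<dots> = \<tau> / (1 - \<beta>)"
        using assms by (simp add: field_simps)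
      finally have "\<beta> * (damped \<tau> \<beta> (\<lambda>_. 1) k + 1) \<le> \<beta> * (\<tau> / (1 - \<beta>))"
        using assms(1) by (rule mult_left_mono)
      with True show ?thesis
        by (simp add: mod_Suc mult.commute)
    next
      case False
      then show ?thesis
        using Suc by (simp add: mod_Suc)
    qed
  qed
  moreover have "real (k mod \<tau>) \<le> real \<tau> - 1"
    using assms(3) mod_less_divisor[of \<tau> k] by linarith
  moreover have "\<tau> / (1 - \<beta>) = \<tau> + \<tau> * \<beta> / (1 - \<beta>)"
    using assms by (simp add: field_simps)
  ultimately show ?thesis by linarith
qed

text \<open>Cauchy-Schwarz for the weights of the damped sum, whose total is the first factor on the
  right. In the induction each factor on the right absorbs one copy of the damping \<open>c\<close>,
  matching \<open>c\<^sup>2\<close> on the left.\<close>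

lemma damped_square_le:
  fixes a :: "nat \<Rightarrow> real"
  assumes "0 \<le> \<beta>"
  shows "(damped \<tau> \<beta> a k)\<^sup>2 \<le> damped \<tau> \<beta> (\<lambda>_. 1) k * damped \<tau> \<beta> (\<lambda>k. (a k)\<^sup>2) k"
proof (induction k)
  case (Suc k)
  define S T x c where "S = damped \<tau> \<beta> (\<lambda>_. 1::real) k" and "T = damped \<tau> \<beta> (\<lambda>k. (a k)\<^sup>2) k"
    and "x = damped \<tau> \<beta> a k" and "c = (if Suc k mod \<tau> = 0 then \<beta> else 1)"
  have ST: "0 \<le> S" "0 \<le> T"
    unfolding S_def T_def using assms by (auto intro!: damped_nonneg)
  have x: "x\<^sup>2 \<le> S * T"
    using Suc by (simp add: S_def T_def x_def)
  \<comment> \<open>With the induction hypothesis in terms of roots, the cross term is bounded by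
    the inequality of arithmetic and geometric means for \<open>sqrt S * \<bar>a k\<bar>\<close> and
    \<open>sqrt T\<close>.\<close>
  have "\<bar>x\<bar> \<le> sqrt S * sqrt T"
    using real_sqrt_le_mono[OF x] by (simp add: real_sqrt_mult)
  then have "2 * (\<bar>x\<bar> * \<bar>a k\<bar>) \<le> 2 * (sqrt S * sqrt T * \<bar>a k\<bar>)"
    by (simp add: mult_right_mono)
  also have "\<dots> \<le> (sqrt S * \<bar>a k\<bar>)\<^sup>2 + (sqrt T)\<^sup>2"
    using sum_squares_bound[of "sqrt S * \<bar>a k\<bar>" "sqrt T"] by (simp add: mult_ac)
  also have "\<dots> = S * (a k)\<^sup>2 + T"
    using ST by (simp add: power_mult_distrib)
  finally have "2 * (x * a k) \<le> S * (a k)\<^sup>2 + T"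
    using abs_ge_self[of "x * a k"] by (simp add: abs_mult)
  then have "(x + a k)\<^sup>2 \<le> (S + 1) * (T + (a k)\<^sup>2)"
    using x by (simp add: power2_eq_square algebra_simps)
  then have "c\<^sup>2 * (x + a k)\<^sup>2 \<le> c\<^sup>2 * ((S + 1) * (T + (a k)\<^sup>2))"
    by (rule mult_left_mono) simp
  then show ?case
    by (simp add: S_def T_def x_def c_def power_mult_distrib power2_eq_square mult_ac)
qed simp

text \<open>The factor \<open>\<tau> / (1 - \<beta>) - K mod \<tau>\<close> is the total weight with which the current value
  enters all later ones.\<close>
lemma sum_damped_le:
  fixes a :: "nat \<Rightarrow> real"
  assumes "0 \<le> \<beta>" "\<beta> < 1" "1 \<le> \<tau>" "\<And>k. 0 \<le> a k"
  shows "(\<Sum>k<K. damped \<tau> \<beta> a k) + (\<tau> / (1 - \<beta>) - real (K mod \<tau>)) * damped \<tau> \<beta> a K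
    \<le> \<tau> / (1 - \<beta>) * (\<Sum>k<K. a k)"
proof (induction K)
  case (Suc K)
  define \<Psi> where "\<Psi> = (\<lambda>k. \<tau> / (1 - \<beta>) - real (k mod \<tau>))"
  define c where "c = (if Suc K mod \<tau> = 0 then \<beta> else 1)"
  \<comment> \<open>Each step uses up one unit of the remaining weight \<open>\<Psi>\<close>. At a
    synchronization \<open>K mod \<tau>\<close> falls from \<open>\<tau> - 1\<close> to 0, and the
    balance is \<open>\<tau> / (1 - \<beta>) * \<beta> = \<tau> / (1 - \<beta>) -
    \<tau>\<close>.\<close>
  have c: "\<Psi> (Suc K) * c = \<Psi> K - 1"
  proof (cases "Suc (K mod \<tau>) = \<tau>")
    case True
    then have "real (K mod \<tau>) = real \<tau> - 1" by linarith
    then have "\<Psi> K - 1 = \<tau> / (1 - \<beta>) - \<tau>" by (simp add: \<Psi>_def)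
    moreover have "\<Psi> (Suc K) * c = \<tau> / (1 - \<beta>) * \<beta>"
      using True by (simp add: \<Psi>_def c_def mod_Suc)
    moreover have "\<tau> / (1 - \<beta>) * \<beta> = \<tau> / (1 - \<beta>) - \<tau>"
      using assms(2) by (simp add: field_simps)
    ultimately show ?thesis by linarith
  next
    case False
    then show ?thesis by (simp add: \<Psi>_def c_def mod_Suc)
  qed
  have IH: "(\<Sum>k<K. damped \<tau> \<beta> a k) + \<Psi> K * damped \<tau> \<beta> a K \<le> \<tau> / (1 - \<beta>) * (\<Sum>k<K. a k)"
    using Suc by (simp add: \<Psi>_def)
  have "\<Psi> (Suc K) * damped \<tau> \<beta> a (Suc K) = (\<Psi> K - 1) * (damped \<tau> \<beta> a K + a K)"
    using c by (simp add: c_def mult.assoc[symmetric])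
  moreover have "(\<Psi> K - 1) * a K \<le> \<tau> / (1 - \<beta>) * a K"
    using assms(4)[of K] by (intro mult_right_mono) (simp_all add: \<Psi>_def)
  ultimately have "(\<Sum>k<Suc K. damped \<tau> \<beta> a k) + \<Psi> (Suc K) * damped \<tau> \<beta> a (Suc K)
      \<le> \<tau> / (1 - \<beta>) * (\<Sum>k<Suc K. a k)"
    using IH unfolding sum.lessThan_Suc by (simp add: algebra_simps del: damped.simps)
  then show ?case by (simp only: \<Psi>_def)
qed simp

text \<open>A Schur-type bound: Cauchy-Schwarz costs one factor
  \<open>\<tau> / (1 - \<beta>)\<close> for the total weight entering a value, and summation over
  \<open>k\<close> a second one for the total weight leaving an input.\<close>

lemma sum_damped_square_le:
  fixes a :: "nat \<Rightarrow> real"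
  assumes "0 \<le> \<beta>" "\<beta> < 1" "1 \<le> \<tau>"
  shows "(\<Sum>k<K. (damped \<tau> \<beta> a k)\<^sup>2) \<le> (\<tau> / (1 - \<beta>))\<^sup>2 * (\<Sum>k<K. (a k)\<^sup>2)"
proof -
  let ?c = "\<tau> / (1 - \<beta>)"
  have c: "real (K mod \<tau>) \<le> ?c"
  proof -
    have "real (K mod \<tau>) \<le> \<tau>" using assms(3) by (simp add: less_imp_le)
    also have "\<dots> \<le> ?c" using assms by (simp add: field_simps)
    finally show ?thesis .
  qed
  have T: "0 \<le> damped \<tau> \<beta> (\<lambda>k. (a k)\<^sup>2) k" for k
    using assms(1) by (intro damped_nonneg) auto
  have "(damped \<tau> \<beta> a k)\<^sup>2 \<le> ?c * damped \<tau> \<beta> (\<lambda>k. (a k)\<^sup>2) k" for k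
    using damped_square_le[OF assms(1), of \<tau> a k] damped_one_le[OF assms, of k]
      mult_right_mono[OF _ T[of k], of "damped \<tau> \<beta> (\<lambda>_. 1) k" ?c] by linarith
  then have "(\<Sum>k<K. (damped \<tau> \<beta> a k)\<^sup>2) \<le> (\<Sum>k<K. ?c * damped \<tau> \<beta> (\<lambda>k. (a k)\<^sup>2) k)"
    by (intro sum_mono)
  also have "\<dots> = ?c * (\<Sum>k<K. damped \<tau> \<beta> (\<lambda>k. (a k)\<^sup>2) k)"
    by (simp add: sum_distrib_left)
  also have "\<dots> \<le> ?c * (?c * (\<Sum>k<K. (a k)\<^sup>2))"
  proof (rule mult_left_mono)
    have "0 \<le> (?c - real (K mod \<tau>)) * damped \<tau> \<beta> (\<lambda>k. (a k)\<^sup>2) K"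
      using c T by simp
    then show "(\<Sum>k<K. damped \<tau> \<beta> (\<lambda>k. (a k)\<^sup>2) k) \<le> ?c * (\<Sum>k<K. (a k)\<^sup>2)"
      using sum_damped_le[OF assms, of "\<lambda>k. (a k)\<^sup>2" K] by simp
  qed (use assms in simp)
  finally show ?thesis by (simp add: power2_eq_square)
qed

section \<open>Means and root mean squares over the workers\<close>

definition mean :: "nat \<Rightarrow> (nat \<Rightarrow> 'a::real_vector) \<Rightarrow> 'a" where
  "mean m f = (1 / real m) *\<^sub>R (\<Sum>i<m. f i)"

text \<open>A rescaled Euclidean norm of the whole family. Its triangle inequality allows inputs to
  be split before squaring, without a loss of constants at every step.\<close>

definition rms :: "nat \<Rightarrow> (nat \<Rightarrow> 'a::real_normed_vector) \<Rightarrow> real" where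
  "rms m f = sqrt (mean m (\<lambda>i. (norm (f i))\<^sup>2))"

lemma mean_real: "mean m f = (\<Sum>i<m. f i) / real m" for f :: "nat \<Rightarrow> real"
  by (simp add: mean_def)

lemma mean_add: "mean m (\<lambda>i. f i + g i) = mean m f + mean m g"
  by (simp add: mean_def sum.distrib scaleR_add_right)

lemma mean_diff: "mean m (\<lambda>i. f i - g i) = mean m f - mean m g"
  by (simp add: mean_def sum_subtractf scaleR_diff_right)

lemma mean_scaleR: "mean m (\<lambda>i. c *\<^sub>R f i) = c *\<^sub>R mean m f"
  by (simp add: mean_def scaleR_sum_right mult.commute)

lemma mean_cmult: "mean m (\<lambda>i. c * f i) = c * mean m f" for f :: "nat \<Rightarrow> real"
  using mean_scaleR[of m c f] by simp

lemma mean_const: "1 \<le> m \<Longrightarrow> mean m (\<lambda>_. c) = c"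
  by (simp add: mean_def sum_constant_scaleR)

lemma mean_mono:
  fixes f g :: "nat \<Rightarrow> real"
  assumes "\<And>i. i < m \<Longrightarrow> f i \<le> g i"
  shows "mean m f \<le> mean m g"
  unfolding mean_real using assms by (auto intro!: divide_right_mono sum_mono)

lemma mean_nonneg: "(\<And>i. i < m \<Longrightarrow> 0 \<le> f i) \<Longrightarrow> 0 \<le> mean m f" for f :: "nat \<Rightarrow> real"
  unfolding mean_real by (auto intro!: divide_nonneg_nonneg sum_nonneg)

lemma mean_inner: "mean m (\<lambda>i. f i \<bullet> c) = mean m f \<bullet> c"
  by (simp add: mean_def inner_sum_left)

lemma mean_cong: "(\<And>i. i < m \<Longrightarrow> f i = g i) \<Longrightarrow> mean m f = mean m g"
  by (simp add: mean_def)

lemma damped_mean: "damped \<tau> \<beta> (\<lambda>k. mean m (a k)) k = mean m (\<lambda>i. damped \<tau> \<beta> (\<lambda>k. a k i) k)"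
  by (simp add: mean_def damped_scaleR damped_sum)

lemma rms_square: "(rms m f)\<^sup>2 = mean m (\<lambda>i. (norm (f i))\<^sup>2)"
  by (simp add: rms_def mean_nonneg)

lemma rms_nonneg: "0 \<le> rms m f"
  by (simp add: rms_def mean_nonneg)

lemma rms_eq_L2_set: "rms m f = L2_set (\<lambda>i. norm (f i)) {..<m} / sqrt (real m)"
  by (simp add: rms_def L2_set_def mean_real real_sqrt_divide)

lemma rms_triangle: "rms m (\<lambda>i. f i + g i) \<le> rms m f + rms m g"
proof -
  have "L2_set (\<lambda>i. norm (f i + g i)) {..<m} \<le> L2_set (\<lambda>i. norm (f i) + norm (g i)) {..<m}"
    by (intro L2_set_mono norm_triangle_ineq norm_ge_zero)
  also have "\<dots> \<le> L2_set (\<lambda>i. norm (f i)) {..<m} + L2_set (\<lambda>i. norm (g i)) {..<m}"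
    by (rule L2_set_triangle_ineq)
  finally show ?thesis
    by (simp add: rms_eq_L2_set add_divide_distrib[symmetric] divide_right_mono)
qed

lemma rms_scaleR: "0 \<le> c \<Longrightarrow> rms m (\<lambda>i. c *\<^sub>R f i) = c * rms m f"
  by (simp add: rms_def power_mult_distrib mean_cmult real_sqrt_mult)

lemma rms_le: "rms m f \<le> rms m g" if "\<And>i. i < m \<Longrightarrow> norm (f i) \<le> norm (g i)"
  unfolding rms_def using that by (auto intro!: real_sqrt_le_mono mean_mono power_mono)

text \<open>The triangle inequality moves \<open>rms\<close> inside the damped sum and leaves a real
  sequence, to which \<open>damped_one_le\<close> and \<open>sum_damped_square_le\<close>
  apply.\<close>

lemma rms_damped_le:
  assumes "0 \<le> \<beta>"
  shows "rms m (\<lambda>i. damped \<tau> \<beta> (\<lambda>k. a k i) k) \<le> damped \<tau> \<beta> (\<lambda>k. rms m (a k)) k"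
proof (induction k)
  case 0
  show ?case by (simp add: rms_def mean_def)
next
  case (Suc k)
  have "rms m (\<lambda>i. damped \<tau> \<beta> (\<lambda>k. a k i) k + a k i) \<le> damped \<tau> \<beta> (\<lambda>k. rms m (a k)) k + rms m (a k)"
    using Suc rms_triangle[of m "\<lambda>i. damped \<tau> \<beta> (\<lambda>k. a k i) k" "a k"] by linarith
  then show ?case
    using assms by (auto simp: rms_scaleR intro: mult_left_mono)
qed

text \<open>Pythagoras: a family with mean zero is orthogonal to every constant family.\<close>

lemma mean_norm_add_square:
  fixes c :: "'a::real_inner"
  assumes "1 \<le> m" "mean m f = 0"
  shows "mean m (\<lambda>i. (norm (f i + c))\<^sup>2) = mean m (\<lambda>i. (norm (f i))\<^sup>2) + (norm c)\<^sup>2"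
proof -
  have "mean m (\<lambda>i. (norm (f i + c))\<^sup>2)
      = mean m (\<lambda>i. (norm (f i))\<^sup>2 + 2 * (f i \<bullet> c) + (norm c)\<^sup>2)"
    by (simp add: power2_norm_eq_inner inner_add inner_commute algebra_simps)
  also have "\<dots> = mean m (\<lambda>i. (norm (f i))\<^sup>2) + 2 * mean m (\<lambda>i. f i \<bullet> c) + (norm c)\<^sup>2"
    by (simp add: mean_add mean_cmult mean_const[OF assms(1)])
  finally show ?thesis by (simp add: mean_inner assms(2))
qed

text \<open>The variance identity; the next two lemmas each drop one of the nonnegative terms on its
  right.\<close>

lemma mean_norm_square_decomp:
  fixes f :: "nat \<Rightarrow> 'a::real_inner"
  assumes "1 \<le> m"
  shows "mean m (\<lambda>i. (norm (f i))\<^sup>2)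
    = mean m (\<lambda>i. (norm (f i - mean m f))\<^sup>2) + (norm (mean m f))\<^sup>2"
  using mean_norm_add_square[OF assms, of "\<lambda>i. f i - mean m f" "mean m f"]
  by (simp add: mean_diff mean_const[OF assms])

lemma rms_centered_le:
  fixes f :: "nat \<Rightarrow> 'a::real_inner"
  assumes "1 \<le> m"
  shows "rms m (\<lambda>i. f i - mean m f) \<le> rms m f"
  unfolding rms_def using mean_norm_square_decomp[OF assms, of f] by simp

lemma norm_mean_square_le:
  fixes f :: "nat \<Rightarrow> 'a::real_inner"
  assumes "1 \<le> m"
  shows "(norm (mean m f))\<^sup>2 \<le> mean m (\<lambda>i. (norm (f i))\<^sup>2)"
  using mean_norm_square_decomp[OF assms, of f] mean_nonneg[of m "\<lambda>i. (norm (f i - mean m f))\<^sup>2"]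
  by simp

text \<open>Young's inequality with a free weight, from expanding the square of
  \<open>sqrt t *\<^sub>R a - (1 / sqrt t) *\<^sub>R b\<close>. It is used below with
  \<open>t\<close> equal to 5/2, 1/4 and 1.\<close>

lemma norm_add_square_le:
  fixes a b :: "'a::real_inner"
  assumes "0 < t"
  shows "(norm (a + b))\<^sup>2 \<le> (1 + t) * (norm a)\<^sup>2 + (1 + 1 / t) * (norm b)\<^sup>2"
proof -
  have "0 \<le> (norm (sqrt t *\<^sub>R a - (1 / sqrt t) *\<^sub>R b))\<^sup>2" by simp
  also have "\<dots> = t * (norm a)\<^sup>2 - 2 * (a \<bullet> b) + (1 / t) * (norm b)\<^sup>2"
  proof -
    have "sqrt t * sqrt t = t" "sqrt t \<noteq> 0" using assms by auto
    then show ?thesis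
      unfolding power2_norm_eq_inner
      by (simp add: inner_diff inner_commute algebra_simps real_sqrt_mult[symmetric])
  qed
  finally have "2 * (a \<bullet> b) \<le> t * (norm a)\<^sup>2 + (1 / t) * (norm b)\<^sup>2" by simp
  moreover have "(norm (a + b))\<^sup>2 = (norm a)\<^sup>2 + 2 * (a \<bullet> b) + (norm b)\<^sup>2"
    unfolding power2_norm_eq_inner by (simp add: inner_add inner_commute)
  ultimately show ?thesis by (simp add: algebra_simps)
qed

section \<open>The iteration along a sample path\<close>

lemma fst_ols_Suc:
  "fst (ols m \<tau> \<alpha> \<gamma> g x0 xi (Suc k)) i =
    (let X = fst (ols m \<tau> \<alpha> \<gamma> g x0 xi k); H = X i - \<gamma> *\<^sub>R g i (X i) (xi k i)
     in if Suc k mod \<tau> = 0 then H - \<alpha> *\<^sub>R (H - snd (ols m \<tau> \<alpha> \<gamma> g x0 xi k)) else H)"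
  by (simp add: Let_def)

lemma snd_ols_Suc:
  "snd (ols m \<tau> \<alpha> \<gamma> g x0 xi (Suc k)) =
    (if Suc k mod \<tau> = 0 then mean m (fst (ols m \<tau> \<alpha> \<gamma> g x0 xi (Suc k)))
     else snd (ols m \<tau> \<alpha> \<gamma> g x0 xi k))"
  by (simp add: Let_def mean_def)

declare ols.simps(2) [simp del]

lemma ols_y_eq: "ols_y m \<tau> \<alpha> \<gamma> g x0 xi k
    = (1 - \<alpha>) *\<^sub>R mean m (fst (ols m \<tau> \<alpha> \<gamma> g x0 xi k)) + \<alpha> *\<^sub>R snd (ols m \<tau> \<alpha> \<gamma> g x0 xi k)"
  by (simp add: ols_y_def mean_def)

definition ols_dir where
  "ols_dir m \<tau> \<alpha> \<gamma> g x0 xi k i = g i (fst (ols m \<tau> \<alpha> \<gamma> g x0 xi k) i) (xi k i)"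

context
  fixes m \<tau> :: nat and \<alpha> \<gamma> :: real and g :: "nat \<Rightarrow> 'a::real_vector \<Rightarrow> 'b \<Rightarrow> 'a" and x0 :: 'a
    and xi :: "nat \<Rightarrow> nat \<Rightarrow> 'b" and X z y G
  assumes m: "1 \<le> m"
  defines "X \<equiv> \<lambda>k. fst (ols m \<tau> \<alpha> \<gamma> g x0 xi k)"
    and "z \<equiv> \<lambda>k. snd (ols m \<tau> \<alpha> \<gamma> g x0 xi k)"
    and "y \<equiv> \<lambda>k. ols_y m \<tau> \<alpha> \<gamma> g x0 xi k"
    and "G \<equiv> \<lambda>k. ols_dir m \<tau> \<alpha> \<gamma> g x0 xi k"
begin

lemma ols_local_Suc: "X (Suc k) i = (if Suc k mod \<tau> = 0
    then (1 - \<alpha>) *\<^sub>R (X k i - \<gamma> *\<^sub>R G k i) + \<alpha> *\<^sub>R z k else X k i - \<gamma> *\<^sub>R G k i)"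
  by (simp add: X_def z_def G_def fst_ols_Suc ols_dir_def Let_def algebra_simps)

lemma ols_mean_local_Suc: "mean m (X (Suc k)) = (if Suc k mod \<tau> = 0
    then (1 - \<alpha>) *\<^sub>R (mean m (X k) - \<gamma> *\<^sub>R mean m (G k)) + \<alpha> *\<^sub>R z k
    else mean m (X k) - \<gamma> *\<^sub>R mean m (G k))"
proof -
  have "mean m (X (Suc k)) = mean m (\<lambda>i. if Suc k mod \<tau> = 0
      then (1 - \<alpha>) *\<^sub>R (X k i - \<gamma> *\<^sub>R G k i) + \<alpha> *\<^sub>R z k else X k i - \<gamma> *\<^sub>R G k i)"
    by (intro mean_cong ols_local_Suc)
  then show ?thesis
    by (simp add: mean_add mean_diff mean_scaleR mean_const[OF m])
qed

lemma ols_anchor_Suc: "z (Suc k) = (if Suc k mod \<tau> = 0 then mean m (X (Suc k)) else z k)"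
  unfolding z_def X_def by (rule snd_ols_Suc)

text \<open>The anchor is common to all workers and cancels in the deviations from their mean, so a
  synchronization only shrinks these by \<open>1 - \<alpha>\<close>.\<close>

lemma ols_dispersion:
  "X k i - mean m (X k) = - \<gamma> *\<^sub>R damped \<tau> (1 - \<alpha>) (\<lambda>k. G k i - mean m (G k)) k"
proof (induction k)
  case 0
  show ?case by (simp add: X_def mean_const[OF m])
next
  case (Suc k)
  have "X (Suc k) i - mean m (X (Suc k))
      = (if Suc k mod \<tau> = 0 then 1 - \<alpha> else 1) *\<^sub>R
        ((X k i - mean m (X k)) - \<gamma> *\<^sub>R (G k i - mean m (G k)))"
    by (simp add: ols_local_Suc ols_mean_local_Suc algebra_simps)
  then show ?case
    by (simp add: Suc algebra_simps)
qed

text \<open>A synchronization moves the anchor to the new mean, hence the factor 0. In between the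
  anchor rests and the gap collects the mean gradient steps.\<close>

lemma ols_anchor_gap: "mean m (X k) - z k = - \<gamma> *\<^sub>R damped \<tau> 0 (\<lambda>k. mean m (G k)) k"
proof (induction k)
  case 0
  show ?case by (simp add: X_def z_def mean_const[OF m])
next
  case (Suc k)
  then show ?case
    by (cases "Suc k mod \<tau> = 0") (simp_all add: ols_anchor_Suc ols_mean_local_Suc algebra_simps)
qed

text \<open>At a synchronization the new mean and the new anchor coincide, so the new
  \<open>y\<close> is their common value, which is the old \<open>y\<close> with the gradient step
  weighted by \<open>1 - \<alpha>\<close>. Otherwise only the mean moves, and it has weight
  \<open>1 - \<alpha>\<close> in \<open>y\<close>.\<close>

lemma ols_y_Suc: "y (Suc k) = y k - ((1 - \<alpha>) * \<gamma>) *\<^sub>R mean m (G k)"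
proof -
  have y: "y k = (1 - \<alpha>) *\<^sub>R mean m (X k) + \<alpha> *\<^sub>R z k" for k
    unfolding y_def X_def z_def by (rule ols_y_eq)
  show ?thesis
    by (cases "Suc k mod \<tau> = 0") (simp_all add: y ols_anchor_Suc ols_mean_local_Suc algebra_simps)
qed

lemma ols_minus_y: "X k i - y k = (X k i - mean m (X k)) + \<alpha> *\<^sub>R (mean m (X k) - z k)"
proof -
  have y: "y k = (1 - \<alpha>) *\<^sub>R mean m (X k) + \<alpha> *\<^sub>R z k"
    unfolding y_def X_def z_def by (rule ols_y_eq)
  show ?thesis
    by (simp add: y algebra_simps)
qed

end

lemma ols_y_0: "1 \<le> m \<Longrightarrow> ols_y m \<tau> \<alpha> \<gamma> g x0 xi 0 = x0"
  by (simp add: ols_y_eq mean_const algebra_simps)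

text \<open>The mean of the inputs is orthogonal to their deviations, and only the deviations are
  subject to the geometric memory \<open>\<tau> / \<alpha>\<close>; the mean is forgotten at every synchronization.\<close>
lemma consensus_bound:
  fixes d n u :: "nat \<Rightarrow> nat \<Rightarrow> 'a::real_inner" and w :: "nat \<Rightarrow> 'a"
    and \<alpha> \<gamma> L \<kappa> :: real and V N :: "nat \<Rightarrow> real"
  assumes m: "1 \<le> m" and tau: "1 \<le> \<tau>" and alpha: "0 < \<alpha>" "\<alpha> < 1"
    and L: "0 \<le> L" and kappa: "0 \<le> \<kappa>" and step: "60 * (\<gamma> * L * \<tau>)\<^sup>2 \<le> \<alpha>\<^sup>2"
    and u: "\<And>k i. u k i = - \<gamma> *\<^sub>R damped \<tau> (1 - \<alpha>)
      (\<lambda>k. (n k i + d k i) - mean m (\<lambda>i. n k i + d k i)) k"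
    and w: "\<And>k. w k = - \<gamma> *\<^sub>R damped \<tau> 0 (\<lambda>k. mean m (\<lambda>i. n k i + d k i)) k"
    and V: "\<And>k. V k = mean m (\<lambda>i. (norm (u k i))\<^sup>2) + \<alpha>\<^sup>2 * (norm (w k))\<^sup>2"
    and N: "\<And>k. N k = mean m (\<lambda>i. (norm (damped \<tau> (1 - \<alpha>) (\<lambda>k. n k i - mean m (n k)) k))\<^sup>2)
        + \<alpha>\<^sup>2 * (norm (damped \<tau> 0 (\<lambda>k. mean m (n k)) k))\<^sup>2"
    and d: "\<And>k. rms m (\<lambda>i. d k i - mean m (d k)) \<le> \<kappa> + L * sqrt (V k)"
  shows "53 / 60 * (\<Sum>k<K. V k) \<le> \<gamma>\<^sup>2 * (7 / 2 * (\<Sum>k<K. N k)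
    + 7 / 4 * \<kappa>\<^sup>2 * (\<tau> / \<alpha>)\<^sup>2 * K + 7 / 5 * \<alpha>\<^sup>2 * (real \<tau>)\<^sup>2 * (\<Sum>k<K. (norm (mean m (d k)))\<^sup>2))"
proof -
  define \<beta> where "\<beta> = 1 - \<alpha>"
  have \<beta>: "0 \<le> \<beta>" "\<beta> < 1" "1 - \<beta> = \<alpha>" using alpha by (auto simp: \<beta>_def)
  define un ud where "un = (\<lambda>k i. damped \<tau> \<beta> (\<lambda>k. n k i - mean m (n k)) k)"
    and "ud = (\<lambda>k i. damped \<tau> \<beta> (\<lambda>k. d k i - mean m (d k)) k)"
  define wn wd where "wn = damped \<tau> 0 (\<lambda>k. mean m (n k))" and "wd = damped \<tau> 0 (\<lambda>k. mean m (d k))"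
  define q where "q = damped \<tau> \<beta> (\<lambda>k. sqrt (V k))"
  define p where "p = damped \<tau> 0 (\<lambda>k. norm (mean m (d k)))"
  have Vnn: "0 \<le> V k" for k
    unfolding V by (intro add_nonneg_nonneg mean_nonneg) auto
  have q0: "0 \<le> q k" for k
    unfolding q_def using Vnn \<beta> by (intro damped_nonneg) auto
  have u': "u k i = - \<gamma> *\<^sub>R (un k i + ud k i)" for k i
    unfolding u un_def ud_def \<beta>_def damped_add[symmetric]
    by (simp add: mean_add algebra_simps)
  have w': "w k = - \<gamma> *\<^sub>R (wn k + wd k)" for k
    unfolding w wn_def wd_def damped_add[symmetric] by (simp add: mean_add)
  \<comment> \<open>The weight 5/2 yields 7/2 for the noise \<open>a\<close> and 7/5 for the drift
    \<open>b\<close>; the drift gets the smaller one because it feeds back into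
    \<open>V\<close>.\<close>
  have split: "(norm (- \<gamma> *\<^sub>R (a + b)))\<^sup>2 \<le> \<gamma>\<^sup>2 * (7 / 2 * (norm a)\<^sup>2 + 7 / 5 * (norm b)\<^sup>2)"
    for a b :: 'a
    using mult_left_mono[OF norm_add_square_le[of "5 / 2" a b], of "\<gamma>\<^sup>2"]
    by (simp add: power_mult_distrib)
  \<comment> \<open>Heterogeneity is a constant input with damped sum at most
    \<open>\<kappa> * (\<tau> / \<alpha>)\<close>. The part proportional to
    \<open>sqrt (V k)\<close> is kept as \<open>q\<close> until it is summed over \<open>k\<close>.
    The weight 1/4 yields 5/4 and 5.\<close>
  have ud_le: "mean m (\<lambda>i. (norm (ud k i))\<^sup>2) \<le> 5 / 4 * \<kappa>\<^sup>2 * (\<tau> / \<alpha>)\<^sup>2 + 5 * L\<^sup>2 * (q k)\<^sup>2" for k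
  proof -
    have "rms m (ud k) \<le> damped \<tau> \<beta> (\<lambda>k. rms m (\<lambda>i. d k i - mean m (d k))) k"
      unfolding ud_def by (rule rms_damped_le[OF \<beta>(1)])
    also have "\<dots> \<le> damped \<tau> \<beta> (\<lambda>k. \<kappa> * 1 + L * sqrt (V k)) k"
      using d \<beta> by (intro damped_mono) (auto simp: rms_nonneg)
    also have "\<dots> = \<kappa> * damped \<tau> \<beta> (\<lambda>_. 1) k + L * q k"
      unfolding q_def damped_add damped_cmult by simp
    also have "\<dots> \<le> \<kappa> * (\<tau> / \<alpha>) + L * q k"
      using mult_left_mono[OF _ kappa, of "damped \<tau> \<beta> (\<lambda>_. 1) k" "\<tau> / \<alpha>"]
        damped_one_le[OF \<beta>(1,2) tau, of k] unfolding \<beta>(3) by linarith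
    finally have "(rms m (ud k))\<^sup>2 \<le> (\<kappa> * (\<tau> / \<alpha>) + L * q k)\<^sup>2"
      by (rule power_mono) (rule rms_nonneg)
    also have "\<dots> \<le> 5 / 4 * (\<kappa> * (\<tau> / \<alpha>))\<^sup>2 + 5 * (L * q k)\<^sup>2"
      using norm_add_square_le[of "1 / 4" "\<kappa> * (\<tau> / \<alpha>)" "L * q k"]
      unfolding real_norm_def power2_abs by simp
    finally show ?thesis
      by (simp add: rms_square power_mult_distrib power_divide)
  qed
  have wd_le: "(norm (wd k))\<^sup>2 \<le> (p k)\<^sup>2" for k
    unfolding wd_def p_def by (intro power_mono norm_damped_le) auto
  have V_le: "V k \<le> \<gamma>\<^sup>2 * (7 / 2 * N k + 7 / 5 * (5 / 4 * \<kappa>\<^sup>2 * (\<tau> / \<alpha>)\<^sup>2 + 5 * L\<^sup>2 * (q k)\<^sup>2)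
      + 7 / 5 * \<alpha>\<^sup>2 * (p k)\<^sup>2)" for k
  proof -
    have "V k \<le> mean m (\<lambda>i. \<gamma>\<^sup>2 * (7 / 2 * (norm (un k i))\<^sup>2 + 7 / 5 * (norm (ud k i))\<^sup>2))
        + \<alpha>\<^sup>2 * (\<gamma>\<^sup>2 * (7 / 2 * (norm (wn k))\<^sup>2 + 7 / 5 * (norm (wd k))\<^sup>2))"
      unfolding V u' w' by (intro add_mono mean_mono mult_left_mono split) auto
    also have "\<dots> = \<gamma>\<^sup>2 * (7 / 2 * N k + 7 / 5 * mean m (\<lambda>i. (norm (ud k i))\<^sup>2)
        + 7 / 5 * \<alpha>\<^sup>2 * (norm (wd k))\<^sup>2)"
      unfolding N un_def[symmetric] wn_def[symmetric] \<beta>_def[symmetric] mean_cmult mean_add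
      by (simp add: algebra_simps un_def wn_def)
    also have "\<dots> \<le> \<gamma>\<^sup>2 * (7 / 2 * N k + 7 / 5 * (5 / 4 * \<kappa>\<^sup>2 * (\<tau> / \<alpha>)\<^sup>2 + 5 * L\<^sup>2 * (q k)\<^sup>2)
      + 7 / 5 * \<alpha>\<^sup>2 * (p k)\<^sup>2)"
      using ud_le[of k] wd_le[of k] by (intro mult_left_mono add_mono) auto
    finally show ?thesis .
  qed
  \<comment> \<open>The deviations have memory \<open>\<tau> / \<alpha>\<close> since
    \<open>1 - \<beta> = \<alpha>\<close>; the reset sum \<open>p\<close> has factor 0 and thus
    memory \<open>\<tau>\<close> only.\<close>
  have q_sum: "(\<Sum>k<K. (q k)\<^sup>2) \<le> (\<tau> / \<alpha>)\<^sup>2 * (\<Sum>k<K. V k)"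
    using sum_damped_square_le[OF \<beta>(1,2) tau, of "\<lambda>k. sqrt (V k)" K] Vnn by (simp add: q_def \<beta>(3))
  have p_sum: "(\<Sum>k<K. (p k)\<^sup>2) \<le> (real \<tau>)\<^sup>2 * (\<Sum>k<K. (norm (mean m (d k)))\<^sup>2)"
    using sum_damped_square_le[of 0 \<tau> "\<lambda>k. norm (mean m (d k))" K] tau by (simp add: p_def)
  have "(\<Sum>k<K. V k) \<le> (\<Sum>k<K. \<gamma>\<^sup>2 * (7 / 2 * N k
      + 7 / 5 * (5 / 4 * \<kappa>\<^sup>2 * (\<tau> / \<alpha>)\<^sup>2 + 5 * L\<^sup>2 * (q k)\<^sup>2) + 7 / 5 * \<alpha>\<^sup>2 * (p k)\<^sup>2))"
    by (intro sum_mono V_le)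
  also have "\<dots> = \<gamma>\<^sup>2 * (7 / 2 * (\<Sum>k<K. N k) + 7 / 4 * \<kappa>\<^sup>2 * (\<tau> / \<alpha>)\<^sup>2 * K
      + 7 * L\<^sup>2 * (\<Sum>k<K. (q k)\<^sup>2) + 7 / 5 * \<alpha>\<^sup>2 * (\<Sum>k<K. (p k)\<^sup>2))"
    by (simp only: sum_distrib_left[symmetric] sum.distrib sum_constant card_lessThan)
      (simp add: algebra_simps)
  also have "\<dots> \<le> \<gamma>\<^sup>2 * (7 / 2 * (\<Sum>k<K. N k) + 7 / 4 * \<kappa>\<^sup>2 * (\<tau> / \<alpha>)\<^sup>2 * K
      + 7 * L\<^sup>2 * ((\<tau> / \<alpha>)\<^sup>2 * (\<Sum>k<K. V k))
      + 7 / 5 * \<alpha>\<^sup>2 * ((real \<tau>)\<^sup>2 * (\<Sum>k<K. (norm (mean m (d k)))\<^sup>2)))"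
    using q_sum p_sum by (intro mult_left_mono add_mono) auto
  finally have *: "(\<Sum>k<K. V k) \<le> \<gamma>\<^sup>2 * (7 / 2 * (\<Sum>k<K. N k) + 7 / 4 * \<kappa>\<^sup>2 * (\<tau> / \<alpha>)\<^sup>2 * K
      + 7 / 5 * \<alpha>\<^sup>2 * (real \<tau>)\<^sup>2 * (\<Sum>k<K. (norm (mean m (d k)))\<^sup>2))
      + 7 * ((\<gamma> * L * \<tau>)\<^sup>2 / \<alpha>\<^sup>2) * (\<Sum>k<K. V k)"
    by (simp add: algebra_simps power_mult_distrib power_divide)
  \<comment> \<open>The sum of \<open>V\<close> stands on both sides of \<open>*\<close>. Its
    coefficient on the right is at most 7/60, so 53/60 of it remains on the left.\<close>
  have "(\<gamma> * L * \<tau>)\<^sup>2 / \<alpha>\<^sup>2 \<le> 1 / 60"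
    using step alpha by (simp add: field_simps)
  then have "7 * ((\<gamma> * L * \<tau>)\<^sup>2 / \<alpha>\<^sup>2) * (\<Sum>k<K. V k) \<le> 7 * (1 / 60) * (\<Sum>k<K. V k)"
    using Vnn by (intro mult_right_mono mult_left_mono sum_nonneg) auto
  with * show ?thesis by simp
qed

section \<open>Smoothness and the descent inequality\<close>

lemma smooth_upper_bound:
  fixes f :: "'a::real_inner \<Rightarrow> real"
  assumes der: "\<And>x. (f has_derivative (\<lambda>h. f' x \<bullet> h)) (at x)"
    and lip: "\<And>x y. norm (f' x - f' y) \<le> L * norm (x - y)"
  shows "f (x + h) \<le> f x + f' x \<bullet> h + L / 2 * (norm h)\<^sup>2"
proof -
  \<comment> \<open>Up to a constant, \<open>\<phi>\<close> is \<open>f\<close> minus its quadratic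
    upper bound along the segment. Cauchy-Schwarz and the Lipschitz condition make its derivative
    nonpositive on [0, 1].\<close>
  define \<phi> where "\<phi> = (\<lambda>t. f (x + t *\<^sub>R h) - t * (f' x \<bullet> h) - L / 2 * t\<^sup>2 * (norm h)\<^sup>2)"
  have "\<phi> 1 \<le> \<phi> 0"
  proof (rule DERIV_nonpos_imp_nonincreasing[of 0 1])
    fix t :: real assume t: "0 \<le> t" "t \<le> 1"
    have "((\<lambda>t. f (x + t *\<^sub>R h)) has_derivative (\<lambda>s. f' (x + t *\<^sub>R h) \<bullet> (s *\<^sub>R h))) (at t)"
      by (rule has_derivative_compose[of "\<lambda>t. x + t *\<^sub>R h" _ _ _ f, OF _ der])
        (auto intro!: derivative_eq_intros)
    then have "((\<lambda>t. f (x + t *\<^sub>R h)) has_real_derivative f' (x + t *\<^sub>R h) \<bullet> h) (at t)"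
      unfolding has_field_derivative_def by (rule has_derivative_eq_rhs) (simp add: fun_eq_iff)
    then have "(\<phi> has_real_derivative f' (x + t *\<^sub>R h) \<bullet> h - f' x \<bullet> h - L * t * (norm h)\<^sup>2) (at t)"
      unfolding \<phi>_def by (auto intro!: derivative_eq_intros simp: power2_eq_square)
    moreover have "f' (x + t *\<^sub>R h) \<bullet> h - f' x \<bullet> h - L * t * (norm h)\<^sup>2 \<le> 0"
    proof -
      have "(f' (x + t *\<^sub>R h) - f' x) \<bullet> h \<le> norm (f' (x + t *\<^sub>R h) - f' x) * norm h"
        by (rule norm_cauchy_schwarz)
      also have "\<dots> \<le> (L * norm ((x + t *\<^sub>R h) - x)) * norm h"
        by (intro mult_right_mono lip) auto
      finally show ?thesis
        using t by (simp add: inner_diff_left power2_eq_square mult_ac)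
    qed
    ultimately show "\<exists>y. DERIV \<phi> t :> y \<and> y \<le> 0" by blast
  qed simp
  then show ?thesis by (simp add: \<phi>_def)
qed

text \<open>Polarization expresses \<open>f' (y k) \<bullet> s k\<close> by the three squares, and
  the quadratic term of the descent lemma turns the coefficient of
  \<open>(norm (s k))\<^sup>2\<close> into \<open>1 - \<eta> * L\<close>. The terms in
  \<open>\<nu>\<close> are kept exactly, since their inner products are to vanish in
  expectation.\<close>

lemma descent_sum:
  fixes f :: "'a::real_inner \<Rightarrow> real" and y s \<nu> :: "nat \<Rightarrow> 'a"
  assumes der: "\<And>x. (f has_derivative (\<lambda>h. f' x \<bullet> h)) (at x)"
    and lip: "\<And>x y. norm (f' x - f' y) \<le> L * norm (x - y)"
    and lower: "\<And>x. c \<le> f x"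
    and y: "\<And>k. y (Suc k) = y k - \<eta> *\<^sub>R (s k + \<nu> k)"
  shows "\<eta> / 2 * (\<Sum>k<K. (norm (f' (y k)))\<^sup>2 + (1 - \<eta> * L) * (norm (s k))\<^sup>2 - (norm (f' (y k) - s k))\<^sup>2)
    \<le> f (y 0) - c + (\<Sum>k<K. L * \<eta>\<^sup>2 / 2 * (norm (\<nu> k))\<^sup>2 + L * \<eta>\<^sup>2 * (s k \<bullet> \<nu> k) - \<eta> * (f' (y k) \<bullet> \<nu> k))"
proof -
  have "f (y K) + \<eta> / 2 * (\<Sum>k<K. (norm (f' (y k)))\<^sup>2 + (1 - \<eta> * L) * (norm (s k))\<^sup>2 - (norm (f' (y k) - s k))\<^sup>2)
    \<le> f (y 0) + (\<Sum>k<K. L * \<eta>\<^sup>2 / 2 * (norm (\<nu> k))\<^sup>2 + L * \<eta>\<^sup>2 * (s k \<bullet> \<nu> k) - \<eta> * (f' (y k) \<bullet> \<nu> k))"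
  proof (induction K)
    case (Suc K)
    have "f (y (Suc K)) \<le> f (y K) + f' (y K) \<bullet> (- \<eta> *\<^sub>R (s K + \<nu> K)) + L / 2 * (norm (- \<eta> *\<^sub>R (s K + \<nu> K)))\<^sup>2"
      using smooth_upper_bound[OF der lip, of "y K" "- \<eta> *\<^sub>R (s K + \<nu> K)"] by (simp add: y)
    also have "\<dots> = f (y K) + (L * \<eta>\<^sup>2 / 2 * (norm (\<nu> K))\<^sup>2 + L * \<eta>\<^sup>2 * (s K \<bullet> \<nu> K) - \<eta> * (f' (y K) \<bullet> \<nu> K))
      - \<eta> / 2 * ((norm (f' (y K)))\<^sup>2 + (1 - \<eta> * L) * (norm (s K))\<^sup>2 - (norm (f' (y K) - s K))\<^sup>2)"
      unfolding power2_norm_eq_inner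
      by (simp add: inner_add inner_diff inner_commute algebra_simps power2_eq_square)
    finally show ?case
      using Suc by (simp add: algebra_simps)
  qed simp
  with lower[of "y K"] show ?thesis by linarith
qed

text \<open>The deterministic part of the argument: the consensus bound, multiplied by 60/53, is
  inserted into the telescoped descent inequality. This turns 7/2 and 7/4 into 210/53 and 105/53 and
  leaves only noise terms to be averaged.\<close>

lemma ols_gradient_sum:
  fixes m \<tau> K :: nat and \<alpha> \<gamma> L \<kappa> c :: real and f :: "'a::euclidean_space \<Rightarrow> real"
    and gradF :: "nat \<Rightarrow> 'a \<Rightarrow> 'a" and g :: "nat \<Rightarrow> 'a \<Rightarrow> 'b \<Rightarrow> 'a" and xi :: "nat \<Rightarrow> nat \<Rightarrow> 'b"
    and x0 :: 'a and \<nu> :: "nat \<Rightarrow> nat \<Rightarrow> 'a"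
  defines "X \<equiv> \<lambda>k. fst (ols m \<tau> \<alpha> \<gamma> g x0 xi k)"
    and "y \<equiv> \<lambda>k. ols_y m \<tau> \<alpha> \<gamma> g x0 xi k"
    and "s \<equiv> \<lambda>k. mean m (\<lambda>i. gradF i (fst (ols m \<tau> \<alpha> \<gamma> g x0 xi k) i))"
    and "\<eta> \<equiv> (1 - \<alpha>) * \<gamma>"
    and "N \<equiv> \<lambda>k. mean m (\<lambda>i. (norm (damped \<tau> (1 - \<alpha>) (\<lambda>k. \<nu> k i - mean m (\<nu> k)) k))\<^sup>2)
        + \<alpha>\<^sup>2 * (norm (damped \<tau> 0 (\<lambda>k. mean m (\<nu> k)) k))\<^sup>2"
  assumes m: "1 \<le> m" and tau: "1 \<le> \<tau>" and alpha: "0 < \<alpha>" "\<alpha> < 1"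
    and gamma: "0 < \<gamma>" and L: "0 < L" and step: "60 * (\<gamma> * L * \<tau>)\<^sup>2 \<le> \<alpha>\<^sup>2"
    and der: "\<And>x. (f has_derivative (\<lambda>h. gradF_glob m gradF x \<bullet> h)) (at x)"
    and lower: "\<And>x. c \<le> f x"
    and smooth: "\<And>i x y. i < m \<Longrightarrow> norm (gradF i x - gradF i y) \<le> L * norm (x - y)"
    and het: "\<And>x. mean m (\<lambda>i. (norm (gradF i x - gradF_glob m gradF x))\<^sup>2) \<le> \<kappa>\<^sup>2"
    and \<nu>: "\<And>k i. \<nu> k i = g i (X k i) (xi k i) - gradF i (X k i)"
  shows "\<eta> / 2 * (\<Sum>k<K. (norm (gradF_glob m gradF (y k)))\<^sup>2)
    \<le> f x0 - c + \<eta> / 2 * ((\<gamma> * L)\<^sup>2 * (210 / 53 * (\<Sum>k<K. N k) + 105 / 53 * \<kappa>\<^sup>2 * (\<tau> / \<alpha>)\<^sup>2 * K))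
      + (\<Sum>k<K. L * \<eta>\<^sup>2 / 2 * (norm (mean m (\<nu> k)))\<^sup>2 + L * \<eta>\<^sup>2 * (s k \<bullet> mean m (\<nu> k))
          - \<eta> * (gradF_glob m gradF (y k) \<bullet> mean m (\<nu> k)))"
proof -
  define d where "d = (\<lambda>k i. gradF i (X k i))"
  define V where "V = (\<lambda>k. (rms m (\<lambda>i. X k i - y k))\<^sup>2)"
  have G: "ols_dir m \<tau> \<alpha> \<gamma> g x0 xi k i = \<nu> k i + d k i" for k i
    by (simp add: \<nu> d_def ols_dir_def X_def)
  have G': "ols_dir m \<tau> \<alpha> \<gamma> g x0 xi k = (\<lambda>i. \<nu> k i + d k i)" for k
    using G by blast
  have s: "s k = mean m (d k)" for k
    by (simp add: s_def d_def X_def)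
  have glob: "gradF_glob m gradF x = mean m (\<lambda>i. gradF i x)" for x
    by (simp add: gradF_glob_def mean_def)
  define u w where "u = (\<lambda>k i. X k i - mean m (X k))"
    and "w = (\<lambda>k. mean m (X k) - snd (ols m \<tau> \<alpha> \<gamma> g x0 xi k))"
  have u: "u k i = - \<gamma> *\<^sub>R damped \<tau> (1 - \<alpha>) (\<lambda>k. (\<nu> k i + d k i) - mean m (\<lambda>i. \<nu> k i + d k i)) k" for k i
    unfolding u_def X_def ols_dispersion[OF m] G' ..
  have w: "w k = - \<gamma> *\<^sub>R damped \<tau> 0 (\<lambda>k. mean m (\<lambda>i. \<nu> k i + d k i)) k" for k
    unfolding w_def X_def ols_anchor_gap[OF m] G' ..
  have Xy: "X k i - y k = u k i + \<alpha> *\<^sub>R w k" for k i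
    unfolding u_def w_def X_def y_def by (rule ols_minus_y[OF m])
  have "mean m (u k) = 0" for k
    by (simp add: u_def mean_diff mean_const[OF m])
  then have V: "V k = mean m (\<lambda>i. (norm (u k i))\<^sup>2) + \<alpha>\<^sup>2 * (norm (w k))\<^sup>2" for k
    unfolding V_def rms_square Xy
    using mean_norm_add_square[OF m, of "u k" "\<alpha> *\<^sub>R w k"] by (simp add: power_mult_distrib)
  have e_le: "rms m (\<lambda>i. gradF i (X k i) - gradF i (y k)) \<le> L * sqrt (V k)" for k
  proof -
    have "rms m (\<lambda>i. gradF i (X k i) - gradF i (y k)) \<le> rms m (\<lambda>i. L *\<^sub>R (X k i - y k))"
      using smooth L by (intro rms_le) simp
    then show ?thesis
      using L by (simp add: rms_scaleR V_def rms_nonneg)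
  qed
  \<comment> \<open>The local gradients are compared with those at the common point
    \<open>y k\<close>, where the heterogeneity bound applies; the rest is a centered perturbation
    controlled by smoothness. Only the square of \<kappa> is constrained, hence the absolute
    value.\<close>
  have dis: "rms m (\<lambda>i. d k i - mean m (d k)) \<le> \<bar>\<kappa>\<bar> + L * sqrt (V k)" for k
  proof -
    let ?a = "\<lambda>i. gradF i (y k) - gradF_glob m gradF (y k)"
    let ?e = "\<lambda>i. gradF i (X k i) - gradF i (y k)"
    have "rms m (\<lambda>i. d k i - mean m (d k)) = rms m (\<lambda>i. ?a i + (?e i - mean m ?e))"
      by (simp add: d_def glob mean_diff)
    also have "\<dots> \<le> rms m ?a + rms m (\<lambda>i. ?e i - mean m ?e)"
      by (rule rms_triangle)
    also have "rms m ?a \<le> \<bar>\<kappa>\<bar>"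
      using real_sqrt_le_mono[OF het[of "y k"]] by (simp add: rms_def)
    also have "rms m (\<lambda>i. ?e i - mean m ?e) \<le> L * sqrt (V k)"
      using rms_centered_le[OF m, of ?e] e_le[of k] by linarith
    finally show ?thesis by simp
  qed
  have bias: "(norm (gradF_glob m gradF (y k) - s k))\<^sup>2 \<le> L\<^sup>2 * V k" for k
  proof -
    have "gradF_glob m gradF (y k) - s k = - mean m (\<lambda>i. gradF i (X k i) - gradF i (y k))"
      by (simp add: glob s mean_diff d_def)
    then have "(norm (gradF_glob m gradF (y k) - s k))\<^sup>2
        \<le> (rms m (\<lambda>i. gradF i (X k i) - gradF i (y k)))\<^sup>2"
      using norm_mean_square_le[OF m, of "\<lambda>i. gradF i (X k i) - gradF i (y k)"]
      by (simp only: rms_square norm_minus_cancel)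
    also have "\<dots> \<le> (L * sqrt (V k))\<^sup>2"
      by (intro power_mono e_le rms_nonneg)
    finally show ?thesis by (simp add: power_mult_distrib V_def)
  qed
  define Q where "Q = 7 / 2 * (\<Sum>k<K. N k) + 7 / 4 * \<kappa>\<^sup>2 * (\<tau> / \<alpha>)\<^sup>2 * K"
  define S where "S = (\<Sum>k<K. (norm (s k))\<^sup>2)"
  have S0: "0 \<le> S" unfolding S_def by (intro sum_nonneg) auto
  have "53 / 60 * (\<Sum>k<K. V k) \<le> \<gamma>\<^sup>2 * (7 / 2 * (\<Sum>k<K. N k)
    + 7 / 4 * \<bar>\<kappa>\<bar>\<^sup>2 * (\<tau> / \<alpha>)\<^sup>2 * K + 7 / 5 * \<alpha>\<^sup>2 * (real \<tau>)\<^sup>2 * (\<Sum>k<K. (norm (mean m (d k)))\<^sup>2))"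
    by (rule consensus_bound[where V = V and N = N and u = u and w = w and n = \<nu> and d = d
          and L = L and \<kappa> = "\<bar>\<kappa>\<bar>", OF m tau alpha _ _ step u w V _ dis])
      (use L in \<open>auto simp: N_def\<close>)
  then have VQ: "53 / 60 * (\<Sum>k<K. V k) \<le> \<gamma>\<^sup>2 * (Q + 7 / 5 * \<alpha>\<^sup>2 * (real \<tau>)\<^sup>2 * S)"
    by (simp add: Q_def S_def s)
  have lip: "norm (gradF_glob m gradF x - gradF_glob m gradF y) \<le> L * norm (x - y)" for x y
  proof -
    have "rms m (\<lambda>i. gradF i x - gradF i y) \<le> rms m (\<lambda>_. L *\<^sub>R (x - y))"
      using smooth L by (intro rms_le) simp
    also have "\<dots> = L * norm (x - y)"
      using L by (simp add: rms_def mean_const[OF m])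
    finally have "(rms m (\<lambda>i. gradF i x - gradF i y))\<^sup>2 \<le> (L * norm (x - y))\<^sup>2"
      by (intro power_mono rms_nonneg)
    then have "(norm (gradF_glob m gradF x - gradF_glob m gradF y))\<^sup>2 \<le> (L * norm (x - y))\<^sup>2"
      using norm_mean_square_le[OF m, of "\<lambda>i. gradF i x - gradF i y"]
      by (simp add: rms_square glob mean_diff)
    then show ?thesis
      using L by (simp add: power2_le_iff_abs_le)
  qed
  have y_Suc: "y (Suc k) = y k - \<eta> *\<^sub>R (s k + mean m (\<nu> k))" for k
    unfolding y_def \<eta>_def s ols_y_Suc[OF m] G' by (simp add: mean_add add.commute)
  define R where "R = (\<Sum>k<K. L * \<eta>\<^sup>2 / 2 * (norm (mean m (\<nu> k)))\<^sup>2 + L * \<eta>\<^sup>2 * (s k \<bullet> mean m (\<nu> k))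
          - \<eta> * (gradF_glob m gradF (y k) \<bullet> mean m (\<nu> k)))"
  define A where "A = (\<Sum>k<K. (norm (gradF_glob m gradF (y k)))\<^sup>2)"
  have "\<eta> / 2 * (\<Sum>k<K. (norm (gradF_glob m gradF (y k)))\<^sup>2 + (1 - \<eta> * L) * (norm (s k))\<^sup>2
      - (norm (gradF_glob m gradF (y k) - s k))\<^sup>2) \<le> f (y 0) - c + R"
    unfolding R_def
    by (rule descent_sum[where \<nu> = "\<lambda>k. mean m (\<nu> k)", OF der lip lower y_Suc])
  moreover have "(\<Sum>k<K. (norm (gradF_glob m gradF (y k)))\<^sup>2 + (1 - \<eta> * L) * (norm (s k))\<^sup>2
      - (norm (gradF_glob m gradF (y k) - s k))\<^sup>2) \<ge> A + (1 - \<eta> * L) * S - L\<^sup>2 * (\<Sum>k<K. V k)"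
    using sum_mono[of "{..<K}", OF bias]
    by (simp add: A_def S_def sum.distrib sum_subtractf sum_distrib_left)
  \<comment> \<open>The consensus bound brings in \<open>S\<close> with coefficient \<open>84 / 53 *
    (\<alpha>\<^sup>2 * (\<gamma> * L * \<tau>)\<^sup>2)\<close>, where 84/53 is 60/53 times 7/5.
    This is far below \<open>1 - \<eta> * L\<close>, which is at least 1/2, so \<open>S\<close>
    disappears.\<close>
  moreover have "A - (\<gamma> * L)\<^sup>2 * (60 / 53 * Q) \<le> A + (1 - \<eta> * L) * S - L\<^sup>2 * (\<Sum>k<K. V k)"
  proof -
    have t: "(\<gamma> * L * \<tau>)\<^sup>2 \<le> 1 / 60"
      using step alpha power_le_one[of \<alpha> 2] by simp
    have "(\<gamma> * L)\<^sup>2 \<le> (\<gamma> * L * \<tau>)\<^sup>2"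
      using gamma L tau by (intro power_mono) auto
    with t have "(\<gamma> * L)\<^sup>2 \<le> (1 / 2)\<^sup>2" by (simp add: power2_eq_square)
    then have "\<gamma> * L \<le> 1 / 2"
      using power2_le_imp_le[of "\<gamma> * L" "1 / 2"] by simp
    moreover have "\<eta> * L \<le> \<gamma> * L"
      using alpha gamma L by (simp add: \<eta>_def)
    ultimately have "\<eta> * L \<le> 1 / 2" by linarith
    moreover have "\<alpha>\<^sup>2 * (\<gamma> * L * \<tau>)\<^sup>2 \<le> 1 * (1 / 60)"
      using alpha t by (intro mult_mono) (auto intro: power_le_one)
    ultimately have "84 / 53 * (\<alpha>\<^sup>2 * (\<gamma> * L * \<tau>)\<^sup>2) \<le> 1 - \<eta> * L" by simp
    then have "84 / 53 * (\<alpha>\<^sup>2 * (\<gamma> * L * \<tau>)\<^sup>2) * S \<le> (1 - \<eta> * L) * S"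
      using S0 by (rule mult_right_mono)
    moreover have "L\<^sup>2 * (\<Sum>k<K. V k) \<le> L\<^sup>2 * (60 / 53 * (\<gamma>\<^sup>2 * (Q + 7 / 5 * \<alpha>\<^sup>2 * (real \<tau>)\<^sup>2 * S)))"
      using VQ by (intro mult_left_mono) auto
    ultimately show ?thesis
      by (simp add: power_mult_distrib algebra_simps)
  qed
  moreover have "0 \<le> \<eta>" using alpha gamma by (simp add: \<eta>_def)
  ultimately have "\<eta> / 2 * (A - (\<gamma> * L)\<^sup>2 * (60 / 53 * Q)) \<le> f (y 0) - c + R"
    by (smt (verit) mult_left_mono divide_nonneg_nonneg)
  moreover have "y 0 = x0"
    unfolding y_def by (rule ols_y_0[OF m])
  ultimately show ?thesis
    unfolding A_def[symmetric] R_def[symmetric] by (simp add: Q_def algebra_simps)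
qed

section \<open>Square integrability and independence\<close>

definition sq_integrable :: "'w measure \<Rightarrow> ('w \<Rightarrow> 'a::euclidean_space) \<Rightarrow> bool" where
  "sq_integrable M f \<longleftrightarrow> f \<in> borel_measurable M \<and> integrable M (\<lambda>\<omega>. (norm (f \<omega>))\<^sup>2)"

lemma sq_integrable_measurable: "sq_integrable M f \<Longrightarrow> f \<in> borel_measurable M"
  by (simp add: sq_integrable_def)

lemma sq_integrable_norm: "sq_integrable M f \<Longrightarrow> integrable M (\<lambda>\<omega>. (norm (f \<omega>))\<^sup>2)"
  by (simp add: sq_integrable_def)

lemma sq_integrableI_bound:
  assumes "f \<in> borel_measurable M" "integrable M h" "\<And>\<omega>. (norm (f \<omega>))\<^sup>2 \<le> h \<omega>"
  shows "sq_integrable M f"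
proof -
  have [measurable]: "f \<in> borel_measurable M" by fact
  show ?thesis
    unfolding sq_integrable_def using assms(3)
    by (intro conjI assms(1) Bochner_Integration.integrable_bound[OF assms(2)])
      (auto intro: order_trans[OF _ abs_ge_self])
qed

lemma sq_integrable_add:
  assumes "sq_integrable M f" "sq_integrable M g"
  shows "sq_integrable M (\<lambda>\<omega>. f \<omega> + g \<omega>)"
  using assms norm_add_square_le[of 1]
  by (intro sq_integrableI_bound[where h = "\<lambda>\<omega>. 2 * (norm (f \<omega>))\<^sup>2 + 2 * (norm (g \<omega>))\<^sup>2"])
    (auto simp: sq_integrable_def)

lemma sq_integrable_scaleR: "sq_integrable M f \<Longrightarrow> sq_integrable M (\<lambda>\<omega>. c *\<^sub>R f \<omega>)"
  by (auto simp: sq_integrable_def power_mult_distrib)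

lemma sq_integrable_diff:
  "sq_integrable M f \<Longrightarrow> sq_integrable M g \<Longrightarrow> sq_integrable M (\<lambda>\<omega>. f \<omega> - g \<omega>)"
  using sq_integrable_add[of M f "\<lambda>\<omega>. - 1 *\<^sub>R g \<omega>"] sq_integrable_scaleR[of M g "- 1"] by simp

lemma sq_integrable_zero: "sq_integrable M (\<lambda>_. 0)"
  by (simp add: sq_integrable_def)

lemma sq_integrable_sum:
  "(\<And>i. i \<in> I \<Longrightarrow> sq_integrable M (f i)) \<Longrightarrow> sq_integrable M (\<lambda>\<omega>. \<Sum>i\<in>I. f i \<omega>)"
  by (induction I rule: infinite_finite_induct) (auto intro: sq_integrable_add sq_integrable_zero)

lemma sq_integrable_mean:
  "(\<And>i. i < m \<Longrightarrow> sq_integrable M (\<lambda>\<omega>. f \<omega> i)) \<Longrightarrow> sq_integrable M (\<lambda>\<omega>. mean m (f \<omega>))"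
  unfolding mean_def by (intro sq_integrable_scaleR sq_integrable_sum) auto

lemma sq_integrable_damped:
  assumes "\<And>k. sq_integrable M (\<lambda>\<omega>. a \<omega> k)"
  shows "sq_integrable M (\<lambda>\<omega>. damped \<tau> \<beta> (a \<omega>) n)"
  by (induction n) (auto intro!: sq_integrable_zero sq_integrable_scaleR sq_integrable_add assms)

lemma (in finite_measure) sq_integrable_const: "sq_integrable M (\<lambda>_. c)"
  by (simp add: sq_integrable_def)

text \<open>A Lipschitz map has linear growth, and the constant \<open>f 0\<close> is square
  integrable because the measure is finite.\<close>

lemma (in finite_measure) sq_integrable_lipschitz:
  fixes f :: "'b::euclidean_space \<Rightarrow> 'c::euclidean_space"
  assumes "sq_integrable M X" "f \<in> borel_measurable borel" "\<And>x y. norm (f x - f y) \<le> L * norm (x - y)"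
  shows "sq_integrable M (\<lambda>\<omega>. f (X \<omega>))"
proof (rule sq_integrableI_bound)
  show "(\<lambda>\<omega>. f (X \<omega>)) \<in> borel_measurable M"
    by (rule measurable_compose[OF sq_integrable_measurable[OF assms(1)] assms(2)])
  show "integrable M (\<lambda>\<omega>. 2 * (norm (f 0))\<^sup>2 + 2 * (L\<^sup>2 * (norm (X \<omega>))\<^sup>2))"
    using assms(1) by (auto simp: sq_integrable_def)
  show "(norm (f (X \<omega>)))\<^sup>2 \<le> 2 * (norm (f 0))\<^sup>2 + 2 * (L\<^sup>2 * (norm (X \<omega>))\<^sup>2)" for \<omega>
  proof -
    have "(norm (f (X \<omega>) - f 0))\<^sup>2 \<le> (L * norm (X \<omega>))\<^sup>2"
      using assms(3)[of "X \<omega>" 0] by (intro power_mono) auto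
    then show ?thesis
      using norm_add_square_le[of 1 "f 0" "f (X \<omega>) - f 0"] by (simp add: power_mult_distrib)
  qed
qed

lemma sq_integrable_inner:
  assumes "sq_integrable M f" "sq_integrable M g"
  shows "integrable M (\<lambda>\<omega>. f \<omega> \<bullet> g \<omega>)"
proof (rule Bochner_Integration.integrable_bound)
  show "integrable M (\<lambda>\<omega>. (norm (f \<omega>))\<^sup>2 + (norm (g \<omega>))\<^sup>2)"
    using assms by (auto simp: sq_integrable_def)
  show "(\<lambda>\<omega>. f \<omega> \<bullet> g \<omega>) \<in> borel_measurable M"
    using assms by (auto simp: sq_integrable_def)
  have "\<bar>f \<omega> \<bullet> g \<omega>\<bar> \<le> (norm (f \<omega>))\<^sup>2 + (norm (g \<omega>))\<^sup>2" for \<omega>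
  proof -
    have "\<bar>f \<omega> \<bullet> g \<omega>\<bar> \<le> norm (f \<omega>) * norm (g \<omega>)"
      by (rule Cauchy_Schwarz_ineq2)
    also have "\<dots> \<le> (norm (f \<omega>))\<^sup>2 + (norm (g \<omega>))\<^sup>2"
      using sum_squares_bound[of "norm (f \<omega>)" "norm (g \<omega>)"]
        mult_nonneg_nonneg[OF norm_ge_zero norm_ge_zero, of "f \<omega>" "g \<omega>"] by linarith
    finally show ?thesis .
  qed
  then show "AE \<omega> in M. norm (f \<omega> \<bullet> g \<omega>) \<le> norm ((norm (f \<omega>))\<^sup>2 + (norm (g \<omega>))\<^sup>2)"
    by (auto intro: order_trans[OF _ abs_ge_self])
qed

lemma integral_norm_add_square:
  assumes "sq_integrable M f" "sq_integrable M g" "(\<integral>\<omega>. f \<omega> \<bullet> g \<omega> \<partial>M) = 0"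
  shows "(\<integral>\<omega>. (norm (f \<omega> + g \<omega>))\<^sup>2 \<partial>M)
    = (\<integral>\<omega>. (norm (f \<omega>))\<^sup>2 \<partial>M) + (\<integral>\<omega>. (norm (g \<omega>))\<^sup>2 \<partial>M)"
proof -
  have "(\<integral>\<omega>. (norm (f \<omega> + g \<omega>))\<^sup>2 \<partial>M)
      = (\<integral>\<omega>. (norm (f \<omega>))\<^sup>2 + 2 * (f \<omega> \<bullet> g \<omega>) + (norm (g \<omega>))\<^sup>2 \<partial>M)"
    unfolding power2_norm_eq_inner
    by (intro Bochner_Integration.integral_cong) (auto simp: inner_add inner_commute)
  then show ?thesis
    using assms sq_integrable_inner[OF assms(1,2)] by (simp add: sq_integrable_def)
qed

text \<open>Each input is orthogonal to the sum accumulated before it, so by Pythagoras the second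
  moments obey the same recursion with squared factor.\<close>

lemma integral_norm_damped_square:
  assumes "\<And>k. sq_integrable M (\<lambda>\<omega>. a \<omega> k)"
    and "\<And>k. (\<integral>\<omega>. damped \<tau> \<beta> (a \<omega>) k \<bullet> a \<omega> k \<partial>M) = 0"
  shows "(\<integral>\<omega>. (norm (damped \<tau> \<beta> (a \<omega>) n))\<^sup>2 \<partial>M)
    = damped \<tau> (\<beta>\<^sup>2) (\<lambda>k. \<integral>\<omega>. (norm (a \<omega> k))\<^sup>2 \<partial>M) n"
proof (induction n)
  case (Suc n)
  have "(\<integral>\<omega>. (norm (damped \<tau> \<beta> (a \<omega>) n + a \<omega> n))\<^sup>2 \<partial>M)
      = damped \<tau> (\<beta>\<^sup>2) (\<lambda>k. \<integral>\<omega>. (norm (a \<omega> k))\<^sup>2 \<partial>M) n + (\<integral>\<omega>. (norm (a \<omega> n))\<^sup>2 \<partial>M)"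
    using Suc integral_norm_add_square[OF sq_integrable_damped assms(1) assms(2)] assms(1) by simp
  then show ?case
    by (simp add: power_mult_distrib)
qed simp

lemma integrable_mean:
  fixes f :: "'w \<Rightarrow> nat \<Rightarrow> real"
  assumes "\<And>i. i < m \<Longrightarrow> integrable M (\<lambda>\<omega>. f \<omega> i)"
  shows "integrable M (\<lambda>\<omega>. mean m (f \<omega>))"
    and "(\<integral>\<omega>. mean m (f \<omega>) \<partial>M) = mean m (\<lambda>i. \<integral>\<omega>. f \<omega> i \<partial>M)"
  unfolding mean_real using assms by (auto intro!: Bochner_Integration.integrable_sum)

section \<open>Independence and integration over a product law\<close>

context prob_space
begin

text \<open>Independence in the form of a product law, since \<^const>\<open>indep_var\<close> requires both
  variables to take values in the same type.\<close>
definition "indep_pair S X T Y \<longleftrightarrow> X \<in> measurable M S \<and> Y \<in> measurable M T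
  \<and> distr M S X \<Otimes>\<^sub>M distr M T Y = distr M (S \<Otimes>\<^sub>M T) (\<lambda>\<omega>. (X \<omega>, Y \<omega>))"

text \<open>Preimages under \<open>G\<close> and \<open>H\<close> are preimages under
  \<open>X\<close> and \<open>Y\<close>, so the product formula carries over to rectangles, which
  determine the product law. Thus \<open>G\<close> can be any quantity determined by
  \<open>X\<close>, without being written as a function of it.\<close>

lemma indep_pair_vimage_algebra:
  assumes "indep_var S X T Y" "G \<in> measurable (vimage_algebra (space M) X S) U"
    and "H \<in> measurable (vimage_algebra (space M) Y T) W"
  shows "indep_pair U G W H"
proof -
  have preimage: "\<exists>B\<in>sets S'. H' -` A \<inter> space M = X' -` B \<inter> space M"
    if "X' \<in> measurable M S'" "H' \<in> measurable (vimage_algebra (space M) X' S') U'" "A \<in> sets U'"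
    for X' H' A and S' :: "'x measure" and U' :: "'y measure"
  proof -
    have "X' \<in> space M \<rightarrow> space S'" using that(1) by (auto simp: measurable_def)
    then show ?thesis
      using measurable_sets[OF that(2,3)] by (auto simp: sets_vimage_algebra2)
  qed
  have rv: "H' \<in> measurable M U'"
    if "X' \<in> measurable M S'" "H' \<in> measurable (vimage_algebra (space M) X' S') U'"
    for X' H' and S' :: "'x measure" and U' :: "'y measure"
  proof (rule measurableI)
    show "H' x \<in> space U'" if "x \<in> space M" for x
      using measurable_space[OF \<open>H' \<in> _\<close>] that by simp
    show "H' -` A \<inter> space M \<in> sets M" if "A \<in> sets U'" for A
      using preimage[OF \<open>X' \<in> _\<close> \<open>H' \<in> _\<close> that] measurable_sets[OF \<open>X' \<in> _\<close>] by auto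
  qed
  have X: "X \<in> measurable M S" and Y: "Y \<in> measurable M T"
    using assms(1) by (blast dest: indep_var_rv1 indep_var_rv2)+
  have G: "G \<in> measurable M U" and H: "H \<in> measurable M W"
    using rv[OF X assms(2)] rv[OF Y assms(3)] .
  have "distr M U G \<Otimes>\<^sub>M distr M W H = distr M (U \<Otimes>\<^sub>M W) (\<lambda>\<omega>. (G \<omega>, H \<omega>))"
  proof (rule pair_measure_eqI)
    show "sigma_finite_measure (distr M U G)" "sigma_finite_measure (distr M W H)"
      using G H by (auto intro: prob_space_imp_sigma_finite prob_space_distr)
    fix A B assume "A \<in> sets (distr M U G)" "B \<in> sets (distr M W H)"
    then have AB: "A \<in> sets U" "B \<in> sets W" by auto
    obtain A' B' where A': "A' \<in> sets S" "G -` A \<inter> space M = X -` A' \<inter> space M"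
      and B': "B' \<in> sets T" "H -` B \<inter> space M = Y -` B' \<inter> space M"
      using preimage[OF X assms(2) AB(1)] preimage[OF Y assms(3) AB(2)] by blast
    have "(\<lambda>\<omega>. (G \<omega>, H \<omega>)) -` (A \<times> B) \<inter> space M = (G -` A \<inter> space M) \<inter> (H -` B \<inter> space M)"
      by auto
    also have "\<dots> = (\<lambda>\<omega>. (X \<omega>, Y \<omega>)) -` (A' \<times> B') \<inter> space M"
      unfolding A'(2) B'(2) by auto
    finally have "emeasure (distr M (U \<Otimes>\<^sub>M W) (\<lambda>\<omega>. (G \<omega>, H \<omega>))) (A \<times> B)
        = emeasure M ((\<lambda>\<omega>. (X \<omega>, Y \<omega>)) -` (A' \<times> B') \<inter> space M)"
      using AB by (subst emeasure_distr[OF measurable_Pair[OF G H]]) auto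
    also have "\<dots> = emeasure (distr M U G) A * emeasure (distr M W H) B"
      using indep_varD[OF assms(1) A'(1) B'(1)] AB G H A'(2) B'(2)
      by (simp add: emeasure_eq_measure ennreal_mult emeasure_distr)
    finally show "emeasure (distr M U G) A * emeasure (distr M W H) B
        = emeasure (distr M (U \<Otimes>\<^sub>M W) (\<lambda>\<omega>. (G \<omega>, H \<omega>))) (A \<times> B)" ..
  qed simp
  then show ?thesis
    using G H by (simp add: indep_pair_def)
qed

text \<open>Tonelli's theorem for the product law takes the place of conditioning on
  \<open>X\<close>: the inner integral runs over \<open>Y\<close> with \<open>X\<close> frozen. The
  next lemma is the version for integrable functions.\<close>

lemma indep_pair_nn_integral:
  assumes "indep_pair S X T Y" "f \<in> borel_measurable (S \<Otimes>\<^sub>M T)"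
  shows "(\<integral>\<^sup>+\<omega>. f (X \<omega>, Y \<omega>) \<partial>M) = (\<integral>\<^sup>+\<omega>. (\<integral>\<^sup>+s. f (X \<omega>, s) \<partial>distr M T Y) \<partial>M)"
proof -
  have [measurable]: "X \<in> measurable M S" and [measurable]: "Y \<in> measurable M T"
    and eq: "distr M S X \<Otimes>\<^sub>M distr M T Y = distr M (S \<Otimes>\<^sub>M T) (\<lambda>x. (X x, Y x))"
    using assms(1) unfolding indep_pair_def by auto
  note [measurable] = assms(2)
  interpret Y: prob_space "distr M T Y" by (rule prob_space_distr) measurable
  have "(\<integral>\<^sup>+\<omega>. f (X \<omega>, Y \<omega>) \<partial>M) = (\<integral>\<^sup>+p. f p \<partial>(distr M S X \<Otimes>\<^sub>M distr M T Y))"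
    unfolding eq by (subst nn_integral_distr) auto
  also have "\<dots> = (\<integral>\<^sup>+x. (\<integral>\<^sup>+s. f (x, s) \<partial>distr M T Y) \<partial>distr M S X)"
    by (subst Y.nn_integral_fst[symmetric]) auto
  also have "\<dots> = (\<integral>\<^sup>+\<omega>. (\<integral>\<^sup>+s. f (X \<omega>, s) \<partial>distr M T Y) \<partial>M)"
    by (subst nn_integral_distr) auto
  finally show ?thesis .
qed

lemma indep_pair_integral:
  fixes f :: "_ \<Rightarrow> real"
  assumes "indep_pair S X T Y" "f \<in> borel_measurable (S \<Otimes>\<^sub>M T)" "integrable M (\<lambda>\<omega>. f (X \<omega>, Y \<omega>))"
  shows "(\<integral>\<omega>. f (X \<omega>, Y \<omega>) \<partial>M) = (\<integral>\<omega>. (\<integral>s. f (X \<omega>, s) \<partial>distr M T Y) \<partial>M)"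
proof -
  have [measurable]: "X \<in> measurable M S" and [measurable]: "Y \<in> measurable M T"
    and eq: "distr M S X \<Otimes>\<^sub>M distr M T Y = distr M (S \<Otimes>\<^sub>M T) (\<lambda>x. (X x, Y x))"
    using assms(1) unfolding indep_pair_def by auto
  note [measurable] = assms(2)
  interpret X: prob_space "distr M S X" by (rule prob_space_distr) measurable
  interpret Y: prob_space "distr M T Y" by (rule prob_space_distr) measurable
  interpret XY: pair_prob_space "distr M S X" "distr M T Y" ..
  have int: "integrable (distr M S X \<Otimes>\<^sub>M distr M T Y) f"
    unfolding eq using assms(3) by (subst integrable_distr_eq) auto
  have "(\<integral>\<omega>. f (X \<omega>, Y \<omega>) \<partial>M) = (\<integral>p. f p \<partial>(distr M S X \<Otimes>\<^sub>M distr M T Y))"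
    unfolding eq by (subst integral_distr) auto
  also have "\<dots> = (\<integral>x. (\<integral>s. f (x, s) \<partial>distr M T Y) \<partial>distr M S X)"
    using XY.integral_fst'[OF int] by simp
  also have "\<dots> = (\<integral>\<omega>. (\<integral>s. f (X \<omega>, s) \<partial>distr M T Y) \<partial>M)"
    by (subst integral_distr) (auto intro!: Y.borel_measurable_lebesgue_integral)
  finally show ?thesis .
qed

end

text \<open>Here \<open>M\<close> is arbitrary and only samples before step \<open>k\<close> enter,
  so the lemma serves both for the full probability space and for the \<sigma>-algebras generated by
  some of the samples.\<close>

lemma ols_measurable:
  fixes g :: "nat \<Rightarrow> 'a::euclidean_space \<Rightarrow> 'b \<Rightarrow> 'a"
  assumes "\<And>i. i < m \<Longrightarrow> (\<lambda>(x, s). g i x s) \<in> borel_measurable (borel \<Otimes>\<^sub>M D i)"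
    and "\<And>j i. j < k \<Longrightarrow> i < m \<Longrightarrow> \<xi> j i \<in> measurable M (D i)"
  shows "\<And>i. i < m \<Longrightarrow> (\<lambda>\<omega>. fst (ols m \<tau> \<alpha> \<gamma> g x0 (\<lambda>k i. \<xi> k i \<omega>) k) i) \<in> borel_measurable M"
    and "(\<lambda>\<omega>. snd (ols m \<tau> \<alpha> \<gamma> g x0 (\<lambda>k i. \<xi> k i \<omega>) k)) \<in> borel_measurable M"
proof -
  have "(\<forall>i<m. (\<lambda>\<omega>. fst (ols m \<tau> \<alpha> \<gamma> g x0 (\<lambda>k i. \<xi> k i \<omega>) k) i) \<in> borel_measurable M)
    \<and> (\<lambda>\<omega>. snd (ols m \<tau> \<alpha> \<gamma> g x0 (\<lambda>k i. \<xi> k i \<omega>) k)) \<in> borel_measurable M"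
    using assms(2)
  proof (induction k)
    case (Suc k)
    let ?X = "\<lambda>\<omega>. fst (ols m \<tau> \<alpha> \<gamma> g x0 (\<lambda>k i. \<xi> k i \<omega>) k)"
    have X: "(\<lambda>\<omega>. ?X \<omega> i) \<in> borel_measurable M" if "i < m" for i
      using Suc that by simp
    have z: "(\<lambda>\<omega>. snd (ols m \<tau> \<alpha> \<gamma> g x0 (\<lambda>k i. \<xi> k i \<omega>) k)) \<in> borel_measurable M"
      using Suc by simp
    have G: "(\<lambda>\<omega>. g i (?X \<omega> i) (\<xi> k i \<omega>)) \<in> borel_measurable M" if "i < m" for i
      using measurable_compose[OF measurable_Pair[OF X[OF that] Suc.prems[OF _ that]] assms(1)[OF that]]
      by simp
    have "(\<lambda>\<omega>. fst (ols m \<tau> \<alpha> \<gamma> g x0 (\<lambda>k i. \<xi> k i \<omega>) (Suc k)) i) \<in> borel_measurable M" if "i < m" for i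
      unfolding fst_ols_Suc Let_def using X[OF that] z G[OF that] by auto
    then show ?case
      unfolding snd_ols_Suc mean_def using z by auto
  qed simp
  then show "\<And>i. i < m \<Longrightarrow> (\<lambda>\<omega>. fst (ols m \<tau> \<alpha> \<gamma> g x0 (\<lambda>k i. \<xi> k i \<omega>) k) i) \<in> borel_measurable M"
    and "(\<lambda>\<omega>. snd (ols m \<tau> \<alpha> \<gamma> g x0 (\<lambda>k i. \<xi> k i \<omega>) k)) \<in> borel_measurable M"
    by auto
qed

section \<open>The gradient noise\<close>

locale overlap_sgd = prob_space P for P :: "'w measure" +
  fixes m \<tau> :: nat and \<alpha> \<gamma> L \<sigma> :: real and D :: "nat \<Rightarrow> 'b measure"
    and gradF :: "nat \<Rightarrow> 'a::euclidean_space \<Rightarrow> 'a" and g :: "nat \<Rightarrow> 'a \<Rightarrow> 'b \<Rightarrow> 'a"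
    and \<xi> :: "nat \<Rightarrow> nat \<Rightarrow> 'w \<Rightarrow> 'b" and x0 :: 'a
  assumes m: "1 \<le> m"
    and D_prob: "\<And>i. i < m \<Longrightarrow> prob_space (D i)"
    and smooth: "\<And>i x y. i < m \<Longrightarrow> norm (gradF i x - gradF i y) \<le> L * norm (x - y)"
    and g_meas: "\<And>i. i < m \<Longrightarrow> (\<lambda>(x, s). g i x s) \<in> borel_measurable (borel \<Otimes>\<^sub>M D i)"
    and g_int: "\<And>i x. i < m \<Longrightarrow> integrable (D i) (g i x)"
    and unbiased: "\<And>i x. i < m \<Longrightarrow> (\<integral>s. g i x s \<partial>D i) = gradF i x"
    and var_int: "\<And>i x. i < m \<Longrightarrow> integrable (D i) (\<lambda>s. (norm (g i x s - gradF i x))\<^sup>2)"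
    and var: "\<And>i x. i < m \<Longrightarrow> (\<integral>s. (norm (g i x s - gradF i x))\<^sup>2 \<partial>D i) \<le> \<sigma>\<^sup>2"
    and indep: "indep_vars (\<lambda>(k, i). D i) (\<lambda>(k, i). \<xi> k i) (UNIV \<times> {..<m})"
    and distr: "\<And>k i. i < m \<Longrightarrow> distr P (D i) (\<xi> k i) = D i"
begin

definition "X \<omega> k = fst (ols m \<tau> \<alpha> \<gamma> g x0 (\<lambda>k i. \<xi> k i \<omega>) k)"

definition "z \<omega> k = snd (ols m \<tau> \<alpha> \<gamma> g x0 (\<lambda>k i. \<xi> k i \<omega>) k)"

definition "noise \<omega> k i = g i (X \<omega> k i) (\<xi> k i \<omega>) - gradF i (X \<omega> k i)"

text \<open>The \<sigma>-algebra generated by the mini-batches with (step, worker) index in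
  \<open>J\<close>. The sets \<open>past k\<close> give the natural filtration; a general
  \<open>J\<close> can also contain some workers of the current step.\<close>

definition "sampled J = vimage_algebra (space P)
  (\<lambda>\<omega>. \<lambda>p\<in>J. (case p of (k, i) \<Rightarrow> \<xi> k i) \<omega>) (PiM J (\<lambda>(k, i). D i))"

abbreviation "past k \<equiv> {..<k} \<times> {..<m}"

lemma \<xi>_measurable: "i < m \<Longrightarrow> \<xi> k i \<in> measurable P (D i)"
  using indep unfolding indep_vars_def by auto

lemma \<xi>_sampled:
  assumes "(k, i) \<in> J" "J \<subseteq> UNIV \<times> {..<m}"
  shows "\<xi> k i \<in> measurable (sampled J) (D i)"
proof -
  let ?R = "\<lambda>\<omega>. \<lambda>p\<in>J. (case p of (k, i) \<Rightarrow> \<xi> k i) \<omega>"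
  have "?R \<in> space P \<rightarrow> space (PiM J (\<lambda>(k, i). D i))"
    using assms(2) measurable_space[OF \<xi>_measurable] by (auto simp: space_PiM split: prod.splits)
  then have "?R \<in> measurable (sampled J) (PiM J (\<lambda>(k, i). D i))"
    unfolding sampled_def by (rule measurable_vimage_algebra1)
  from measurable_compose[OF this measurable_component_singleton[OF assms(1)]]
  show ?thesis
    using assms(1) by simp
qed

lemma X_sampled:
  assumes "past k \<subseteq> J" "J \<subseteq> UNIV \<times> {..<m}" "i < m"
  shows "(\<lambda>\<omega>. X \<omega> k i) \<in> borel_measurable (sampled J)"
  unfolding X_def using assms by (intro ols_measurable(1)[OF g_meas \<xi>_sampled]) auto

lemma X_measurable: "i < m \<Longrightarrow> (\<lambda>\<omega>. X \<omega> k i) \<in> borel_measurable P"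
  unfolding X_def by (intro ols_measurable(1)[OF g_meas \<xi>_measurable]) auto

lemma z_sampled: "past k \<subseteq> J \<Longrightarrow> J \<subseteq> UNIV \<times> {..<m} \<Longrightarrow> (\<lambda>\<omega>. z \<omega> k) \<in> borel_measurable (sampled J)"
  unfolding z_def by (intro ols_measurable(2)[OF g_meas \<xi>_sampled]) auto

lemma gradF_measurable: "i < m \<Longrightarrow> gradF i \<in> borel_measurable borel"
proof (intro borel_measurable_continuous_onI)
  assume i: "i < m"
  have "\<bar>L\<bar>-lipschitz_on UNIV (gradF i)"
  proof (rule lipschitz_onI)
    show "dist (gradF i x) (gradF i y) \<le> \<bar>L\<bar> * dist x y" for x y
      using smooth[OF i, of x y] mult_right_mono[OF abs_ge_self[of L] norm_ge_zero[of "x - y"]]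
      by (simp add: dist_norm)
  qed simp
  then show "continuous_on UNIV (gradF i)"
    by (rule lipschitz_on_continuous_on)
qed

lemma noise_fun_measurable:
  assumes "i < m"
  shows "(\<lambda>(x, s). g i x s - gradF i x) \<in> borel_measurable (borel \<Otimes>\<^sub>M D i)"
proof -
  have [measurable]: "(\<lambda>p. g i (fst p) (snd p)) \<in> borel_measurable (borel \<Otimes>\<^sub>M D i)"
    using g_meas[OF assms] by (simp add: case_prod_unfold)
  note [measurable] = gradF_measurable[OF assms]
  show ?thesis by (simp add: case_prod_unfold)
qed

lemma noise_sampled:
  assumes "past k \<subseteq> J" "(k, i) \<in> J" "J \<subseteq> UNIV \<times> {..<m}"
  shows "(\<lambda>\<omega>. noise \<omega> k i) \<in> borel_measurable (sampled J)"
proof -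
  have i: "i < m" using assms by auto
  show ?thesis
    unfolding noise_def
    using measurable_compose[OF measurable_Pair[OF X_sampled[OF assms(1,3) i] \<xi>_sampled[OF assms(2,3)]]
        noise_fun_measurable[OF i]] by simp
qed

text \<open>\<open>J\<close> and the singleton of \<open>(k, i)\<close> are disjoint blocks of an
  independent family, so a fresh mini-batch is independent of everything determined by
  \<open>J\<close>.\<close>

lemma indep_sampled:
  assumes "H \<in> measurable (sampled J) U" "J \<subseteq> UNIV \<times> {..<m}" "(k, i) \<notin> J" "i < m"
  shows "indep_pair U H (D i) (\<xi> k i)"
proof (rule indep_pair_vimage_algebra)
  let ?\<xi> = "\<lambda>p. case p of (k, i) \<Rightarrow> \<xi> k i" and ?D = "\<lambda>p. case p of (k, i) \<Rightarrow> D i"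
  show "indep_var (PiM J ?D) (\<lambda>\<omega>. \<lambda>p\<in>J. ?\<xi> p \<omega>) (PiM {(k, i)} ?D) (\<lambda>\<omega>. \<lambda>p\<in>{(k, i)}. ?\<xi> p \<omega>)"
    using assms by (intro indep_var_restrict[OF indep]) auto
qed (use assms \<xi>_sampled[of k i "{(k, i)}"] in \<open>auto simp: sampled_def\<close>)

text \<open>The current model depends on past samples only, so the variance bound applies to the
  inner integral at a frozen model. The nonnegative integral is used because finiteness is itself an
  outcome of the computation.\<close>

lemma noise_square:
  assumes i: "i < m"
  shows "sq_integrable P (\<lambda>\<omega>. noise \<omega> k i)" (is ?int)
    and "(\<integral>\<omega>. (norm (noise \<omega> k i))\<^sup>2 \<partial>P) \<le> \<sigma>\<^sup>2" (is ?le)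
proof -
  have meas: "(\<lambda>\<omega>. noise \<omega> k i) \<in> borel_measurable P"
    unfolding noise_def
    using measurable_compose[OF measurable_Pair[OF X_measurable[OF i] \<xi>_measurable[OF i]]
        noise_fun_measurable[OF i]] by simp
  have ind: "indep_pair borel (\<lambda>\<omega>. X \<omega> k i) (D i) (\<xi> k i)"
    using i by (intro indep_sampled[OF X_sampled, of k "past k"]) auto
  have "(\<integral>\<^sup>+\<omega>. ennreal ((norm (noise \<omega> k i))\<^sup>2) \<partial>P)
      = (\<integral>\<^sup>+\<omega>. (\<integral>\<^sup>+s. ennreal ((norm (g i (X \<omega> k i) s - gradF i (X \<omega> k i)))\<^sup>2) \<partial>D i) \<partial>P)"
    using indep_pair_nn_integral[OF ind, of "\<lambda>(x, s). ennreal ((norm (g i x s - gradF i x))\<^sup>2)"]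
      noise_fun_measurable[OF i] by (simp add: noise_def distr[OF i] case_prod_unfold)
  also have "\<dots> \<le> (\<integral>\<^sup>+\<omega>. ennreal (\<sigma>\<^sup>2) \<partial>P)"
  proof (rule nn_integral_mono)
    fix \<omega>
    show "(\<integral>\<^sup>+s. ennreal ((norm (g i (X \<omega> k i) s - gradF i (X \<omega> k i)))\<^sup>2) \<partial>D i) \<le> ennreal (\<sigma>\<^sup>2)"
      using var[OF i] by (subst nn_integral_eq_integral[OF var_int[OF i]]) (auto intro: ennreal_leI)
  qed
  also have "\<dots> = ennreal (\<sigma>\<^sup>2)"
    by (simp add: emeasure_space_1)
  finally have le: "(\<integral>\<^sup>+\<omega>. ennreal ((norm (noise \<omega> k i))\<^sup>2) \<partial>P) \<le> ennreal (\<sigma>\<^sup>2)" .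
  then have "(\<integral>\<^sup>+\<omega>. ennreal ((norm (noise \<omega> k i))\<^sup>2) \<partial>P) < \<infinity>"
    by (rule le_less_trans) simp
  then show ?int
    unfolding sq_integrable_def using meas by (auto intro!: integrableI_nonneg)
  then show ?le
    using le by (simp add: sq_integrable_def nn_integral_eq_integral)
qed

text \<open>With \<open>H\<close> and the model frozen, the noise integrates to zero over the fresh
  mini-batch by unbiasedness. Since \<open>J\<close> may contain other workers of step
  \<open>k\<close>, this covers orthogonality over time and between workers.\<close>

lemma noise_orthogonal:
  assumes H: "H \<in> borel_measurable (sampled J)" "sq_integrable P H"
    and J: "past k \<subseteq> J" "J \<subseteq> UNIV \<times> {..<m}" "(k, i) \<notin> J" and i: "i < m"
  shows "(\<integral>\<omega>. H \<omega> \<bullet> noise \<omega> k i \<partial>P) = 0"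
proof -
  interpret D: prob_space "D i" by (rule D_prob[OF i])
  let ?f = "\<lambda>((h, x), s). h \<bullet> (g i x s - gradF i x)"
  have "(\<lambda>\<omega>. (H \<omega>, X \<omega> k i)) \<in> measurable (sampled J) (borel \<Otimes>\<^sub>M borel)"
    using H(1) X_sampled[OF J(1,2) i] by (rule measurable_Pair)
  then have ind: "indep_pair (borel \<Otimes>\<^sub>M borel) (\<lambda>\<omega>. (H \<omega>, X \<omega> k i)) (D i) (\<xi> k i)"
    by (rule indep_sampled[OF _ J(2,3) i])
  have "?f \<in> borel_measurable ((borel \<Otimes>\<^sub>M borel) \<Otimes>\<^sub>M D i)"
  proof -
    have "(\<lambda>p. (snd (fst p), snd p)) \<in> measurable ((borel \<Otimes>\<^sub>M borel) \<Otimes>\<^sub>M D i) (borel \<Otimes>\<^sub>M D i)"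
      by measurable
    from measurable_compose[OF this noise_fun_measurable[OF i]]
    have [measurable]: "(\<lambda>p. g i (snd (fst p)) (snd p) - gradF i (snd (fst p)))
        \<in> borel_measurable ((borel \<Otimes>\<^sub>M borel) \<Otimes>\<^sub>M D i)" by simp
    have "(\<lambda>p. fst (fst p) \<bullet> (g i (snd (fst p)) (snd p) - gradF i (snd (fst p))))
        \<in> borel_measurable ((borel \<Otimes>\<^sub>M borel) \<Otimes>\<^sub>M D i)" by measurable
    then show ?thesis by (simp add: case_prod_unfold)
  qed
  moreover have "integrable P (\<lambda>\<omega>. ?f ((H \<omega>, X \<omega> k i), \<xi> k i \<omega>))"
    using sq_integrable_inner[OF H(2) noise_square(1)[OF i]] by (simp add: noise_def)
  ultimately have "(\<integral>\<omega>. ?f ((H \<omega>, X \<omega> k i), \<xi> k i \<omega>) \<partial>P)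
      = (\<integral>\<omega>. (\<integral>s. ?f ((H \<omega>, X \<omega> k i), s) \<partial>distr P (D i) (\<xi> k i)) \<partial>P)"
    by (rule indep_pair_integral[OF ind])
  also have "\<dots> = (\<integral>\<omega>. H \<omega> \<bullet> (\<integral>s. g i (X \<omega> k i) s - gradF i (X \<omega> k i) \<partial>D i) \<partial>P)"
    using g_int[OF i] by (simp add: distr[OF i])
  also have "\<dots> = 0"
    using g_int[OF i] unbiased[OF i] by (simp add: D.prob_space)
  finally show ?thesis by (simp add: noise_def)
qed

lemma mean_noise_orthogonal:
  assumes "H \<in> borel_measurable (sampled (past k))" "sq_integrable P H"
  shows "(\<integral>\<omega>. H \<omega> \<bullet> mean m (noise \<omega> k) \<partial>P) = 0"
proof -
  have "(\<integral>\<omega>. H \<omega> \<bullet> mean m (noise \<omega> k) \<partial>P) = (1 / real m) * (\<Sum>i<m. \<integral>\<omega>. H \<omega> \<bullet> noise \<omega> k i \<partial>P)"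
    using sq_integrable_inner[OF assms(2) noise_square(1)]
    by (simp add: mean_def inner_sum_right Bochner_Integration.integral_sum)
  also have "\<dots> = 0"
    using noise_orthogonal[OF assms, of k] by (auto intro!: sum.neutral)
  finally show ?thesis .
qed

lemma sq_integrable_mean_noise: "sq_integrable P (\<lambda>\<omega>. mean m (noise \<omega> k))"
  by (intro sq_integrable_mean noise_square)

lemma mean_noise_square: "(\<integral>\<omega>. (norm (mean m (noise \<omega> k)))\<^sup>2 \<partial>P) \<le> \<sigma>\<^sup>2 / m"
proof -
  have sq: "sq_integrable P (\<lambda>\<omega>. \<Sum>i<l. noise \<omega> k i)" if "l \<le> m" for l
    using that by (intro sq_integrable_sum noise_square) auto
  have "(\<integral>\<omega>. (norm (\<Sum>i<l. noise \<omega> k i))\<^sup>2 \<partial>P) \<le> l * \<sigma>\<^sup>2" if "l \<le> m" for l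
    using that
  proof (induction l)
    case (Suc l)
    \<comment> \<open>Workers are added one at a time: the past and the current mini-batches of the
      workers below \<open>l\<close> determine the partial sum and exclude that of worker
      \<open>l\<close>. The second moments thus add up, which gives the gain of 1/m.\<close>
    let ?J = "past k \<union> {k} \<times> {..<l}"
    have "(\<lambda>\<omega>. \<Sum>i<l. noise \<omega> k i) \<in> borel_measurable (sampled ?J)"
      using Suc.prems by (intro borel_measurable_sum noise_sampled) auto
    then have "(\<integral>\<omega>. (\<Sum>i<l. noise \<omega> k i) \<bullet> noise \<omega> k l \<partial>P) = 0"
      using Suc.prems by (intro noise_orthogonal[OF _ sq, of l ?J]) auto
    then have "(\<integral>\<omega>. (norm ((\<Sum>i<l. noise \<omega> k i) + noise \<omega> k l))\<^sup>2 \<partial>P)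
        = (\<integral>\<omega>. (norm (\<Sum>i<l. noise \<omega> k i))\<^sup>2 \<partial>P) + (\<integral>\<omega>. (norm (noise \<omega> k l))\<^sup>2 \<partial>P)"
      using Suc.prems by (intro integral_norm_add_square sq noise_square) auto
    then show ?case
      using Suc noise_square(2)[of l k] by (simp add: algebra_simps)
  qed simp
  from this[of m] m show ?thesis
    by (simp add: mean_def power_mult_distrib power2_eq_square field_simps)
qed

lemma sq_integrable_gradF:
  assumes "i < m" "sq_integrable P Y"
  shows "sq_integrable P (\<lambda>\<omega>. gradF i (Y \<omega>))"
  by (intro sq_integrable_lipschitz[OF assms(2) gradF_measurable[OF assms(1)] smooth[OF assms(1)]])

lemma sq_integrable_X_z: "(\<forall>i<m. sq_integrable P (\<lambda>\<omega>. X \<omega> k i)) \<and> sq_integrable P (\<lambda>\<omega>. z \<omega> k)"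
proof (induction k)
  case 0
  show ?case by (simp add: X_def z_def sq_integrable_const)
next
  case (Suc k)
  have H: "sq_integrable P (\<lambda>\<omega>. X \<omega> k i - \<gamma> *\<^sub>R (noise \<omega> k i + gradF i (X \<omega> k i)))" if "i < m" for i
    using Suc that by (intro sq_integrable_diff sq_integrable_scaleR sq_integrable_add noise_square
      sq_integrable_gradF) auto
  have "X \<omega> (Suc k) i = (let H = X \<omega> k i - \<gamma> *\<^sub>R (noise \<omega> k i + gradF i (X \<omega> k i))
      in if Suc k mod \<tau> = 0 then H - \<alpha> *\<^sub>R (H - z \<omega> k) else H)" for \<omega> i
    by (simp add: X_def z_def noise_def fst_ols_Suc Let_def)
  then have X: "sq_integrable P (\<lambda>\<omega>. X \<omega> (Suc k) i)" if "i < m" for i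
    using H[OF that] Suc
    by (cases "Suc k mod \<tau> = 0") (auto simp: Let_def intro!: sq_integrable_diff sq_integrable_scaleR)
  have "z \<omega> (Suc k) = (if Suc k mod \<tau> = 0 then mean m (X \<omega> (Suc k)) else z \<omega> k)" for \<omega>
    unfolding X_def z_def by (rule snd_ols_Suc)
  then have "sq_integrable P (\<lambda>\<omega>. z \<omega> (Suc k))"
    using X Suc by (cases "Suc k mod \<tau> = 0") (auto intro: sq_integrable_mean)
  then show ?case using X by simp
qed

text \<open>Orthogonal increments square the factor, and
  \<open>1 - (1 - \<alpha>)\<^sup>2 = (2 - \<alpha>) * \<alpha>\<close> becomes the denominator.
  Deviations and mean of the noise share a single variance budget \<open>\<sigma>\<^sup>2\<close>
  per step.\<close>

lemma damped_noise_square: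
  assumes tau: "1 \<le> \<tau>" and alpha: "0 < \<alpha>" "\<alpha> < 1"
  shows "integrable P (\<lambda>\<omega>. mean m (\<lambda>i. (norm (damped \<tau> (1 - \<alpha>) (\<lambda>k. noise \<omega> k i - mean m (noise \<omega> k)) n))\<^sup>2)
        + \<alpha>\<^sup>2 * (norm (damped \<tau> 0 (\<lambda>k. mean m (noise \<omega> k)) n))\<^sup>2)" (is "integrable P ?N")
    and "(\<integral>\<omega>. mean m (\<lambda>i. (norm (damped \<tau> (1 - \<alpha>) (\<lambda>k. noise \<omega> k i - mean m (noise \<omega> k)) n))\<^sup>2)
        + \<alpha>\<^sup>2 * (norm (damped \<tau> 0 (\<lambda>k. mean m (noise \<omega> k)) n))\<^sup>2 \<partial>P)
      \<le> \<sigma>\<^sup>2 * (\<tau> / ((2 - \<alpha>) * \<alpha>) - 1)"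
proof -
  let ?c = "\<lambda>\<omega> k i. noise \<omega> k i - mean m (noise \<omega> k)"
  have sqc: "sq_integrable P (\<lambda>\<omega>. ?c \<omega> k i)" if "i < m" for k i
    using that by (intro sq_integrable_diff noise_square sq_integrable_mean_noise)
  have meas_noise: "(\<lambda>\<omega>. noise \<omega> j i) \<in> borel_measurable (sampled (past k))" if "j < k" "i < m" for i j k
    using that by (intro noise_sampled) auto
  have meas_mean: "(\<lambda>\<omega>. mean m (noise \<omega> j)) \<in> borel_measurable (sampled (past k))" if "j < k" for j k
    unfolding mean_def using meas_noise[OF that] by (intro borel_measurable_scaleR borel_measurable_sum) auto
  have meas_damped: "(\<lambda>\<omega>. damped \<tau> \<beta> (a \<omega>) n) \<in> borel_measurable M"
    if "\<And>j. j < n \<Longrightarrow> (\<lambda>\<omega>. a \<omega> j) \<in> borel_measurable M"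
    for M :: "'w measure" and a :: "'w \<Rightarrow> nat \<Rightarrow> 'a" and n \<beta>
    using that by (induction n) auto
  \<comment> \<open>The deviation of worker \<open>i\<close> involves the current noise of all
    workers; the past sum is orthogonal to both of its parts.\<close>
  have orth_c: "(\<integral>\<omega>. damped \<tau> (1 - \<alpha>) (\<lambda>k. ?c \<omega> k i) k \<bullet> ?c \<omega> k i \<partial>P) = 0" if i: "i < m" for i k
  proof -
    let ?H = "\<lambda>\<omega>. damped \<tau> (1 - \<alpha>) (\<lambda>k. ?c \<omega> k i) k"
    have H: "?H \<in> borel_measurable (sampled (past k))"
      using i by (intro meas_damped borel_measurable_diff meas_noise meas_mean) auto
    have sqH: "sq_integrable P ?H"
      by (intro sq_integrable_damped sqc i)
    have "(\<integral>\<omega>. ?H \<omega> \<bullet> noise \<omega> k i \<partial>P) = 0"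
      by (rule noise_orthogonal[OF H sqH _ _ _ i]) auto
    with mean_noise_orthogonal[OF H sqH] show ?thesis
      using sq_integrable_inner[OF sqH noise_square(1)[OF i]] sq_integrable_inner[OF sqH sq_integrable_mean_noise]
      by (simp add: inner_diff_right)
  qed
  have orth_m: "(\<integral>\<omega>. damped \<tau> 0 (\<lambda>k. mean m (noise \<omega> k)) k \<bullet> mean m (noise \<omega> k) \<partial>P) = 0" for k
    by (intro mean_noise_orthogonal meas_damped meas_mean sq_integrable_damped sq_integrable_mean_noise)
  have int_c: "integrable P (\<lambda>\<omega>. (norm (damped \<tau> (1 - \<alpha>) (\<lambda>k. ?c \<omega> k i) n))\<^sup>2)" if "i < m" for i
    using that by (intro sq_integrable_norm sq_integrable_damped sqc)
  have int_m: "integrable P (\<lambda>\<omega>. (norm (damped \<tau> 0 (\<lambda>k. mean m (noise \<omega> k)) n))\<^sup>2)"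
    by (intro sq_integrable_norm sq_integrable_damped sq_integrable_mean_noise)
  show "integrable P ?N"
    using int_c int_m by (intro Bochner_Integration.integrable_add integrable_mean(1)) auto
  define v where "v = (\<lambda>k. mean m (\<lambda>i. \<integral>\<omega>. (norm (?c \<omega> k i))\<^sup>2 \<partial>P))"
  define e where "e = (\<lambda>k. \<integral>\<omega>. (norm (mean m (noise \<omega> k)))\<^sup>2 \<partial>P)"
  have ve: "v k + e k \<le> \<sigma>\<^sup>2" for k
  proof -
    have "v k + e k = (\<integral>\<omega>. mean m (\<lambda>i. (norm (?c \<omega> k i))\<^sup>2) + (norm (mean m (noise \<omega> k)))\<^sup>2 \<partial>P)"
      unfolding v_def e_def using sqc sq_integrable_mean_noise
      by (subst Bochner_Integration.integral_add) (auto simp: sq_integrable_def integrable_mean)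
    also have "\<dots> = (\<integral>\<omega>. mean m (\<lambda>i. (norm (noise \<omega> k i))\<^sup>2) \<partial>P)"
      by (simp add: mean_norm_square_decomp[OF m, of "noise _ k"])
    also have "\<dots> = mean m (\<lambda>i. \<integral>\<omega>. (norm (noise \<omega> k i))\<^sup>2 \<partial>P)"
      using noise_square(1) by (intro integrable_mean) (simp add: sq_integrable_def)
    also have "\<dots> \<le> mean m (\<lambda>_. \<sigma>\<^sup>2)"
      by (intro mean_mono noise_square)
    finally show ?thesis by (simp add: mean_const[OF m])
  qed
  have v0: "0 \<le> v k" and e0: "0 \<le> e k" for k
    unfolding v_def e_def by (auto intro!: mean_nonneg)
  have \<beta>: "(1 - \<alpha>)\<^sup>2 < 1" "1 - (1 - \<alpha>)\<^sup>2 = (2 - \<alpha>) * \<alpha>"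
    using alpha by (auto simp: power2_eq_square algebra_simps mult_less_cancel_left)
  have "(\<integral>\<omega>. ?N \<omega> \<partial>P) = mean m (\<lambda>i. \<integral>\<omega>. (norm (damped \<tau> (1 - \<alpha>) (\<lambda>k. ?c \<omega> k i) n))\<^sup>2 \<partial>P)
      + \<alpha>\<^sup>2 * (\<integral>\<omega>. (norm (damped \<tau> 0 (\<lambda>k. mean m (noise \<omega> k)) n))\<^sup>2 \<partial>P)"
    using int_c int_m by (subst Bochner_Integration.integral_add) (auto simp: integrable_mean)
  also have "\<dots> = mean m (\<lambda>i. damped \<tau> ((1 - \<alpha>)\<^sup>2) (\<lambda>k. \<integral>\<omega>. (norm (?c \<omega> k i))\<^sup>2 \<partial>P) n)
      + \<alpha>\<^sup>2 * damped \<tau> 0 e n"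
    unfolding e_def using integral_norm_damped_square[OF sqc orth_c]
      integral_norm_damped_square[OF sq_integrable_mean_noise orth_m]
    by (simp cong: mean_cong)
  also have "\<dots> = damped \<tau> ((1 - \<alpha>)\<^sup>2) v n + \<alpha>\<^sup>2 * damped \<tau> 0 e n"
    unfolding v_def damped_mean ..
  \<comment> \<open>Raising \<open>\<alpha>\<^sup>2\<close> to 1 and the reset factor 0 to
    \<open>(1 - \<alpha>)\<^sup>2\<close> puts both parts under the same damping, so that they
    combine to \<open>v k + e k\<close>.\<close>
  also have "\<dots> \<le> damped \<tau> ((1 - \<alpha>)\<^sup>2) v n + 1 * damped \<tau> ((1 - \<alpha>)\<^sup>2) e n"
    using alpha e0 by (intro add_left_mono mult_mono damped_mono damped_nonneg power_le_one) auto
  also have "\<dots> = damped \<tau> ((1 - \<alpha>)\<^sup>2) (\<lambda>k. v k + e k) n"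
    by (simp add: damped_add)
  also have "\<dots> \<le> damped \<tau> ((1 - \<alpha>)\<^sup>2) (\<lambda>k. \<sigma>\<^sup>2 * 1) n"
    using ve v0 e0 by (intro damped_mono) auto
  also have "\<dots> = \<sigma>\<^sup>2 * damped \<tau> ((1 - \<alpha>)\<^sup>2) (\<lambda>k. 1) n"
    unfolding damped_cmult ..
  also have "\<dots> \<le> \<sigma>\<^sup>2 * (\<tau> / ((2 - \<alpha>) * \<alpha>) - 1)"
    using damped_one_le[OF _ \<beta>(1) tau, of n] unfolding \<beta>(2) by (intro mult_left_mono) auto
  finally show "(\<integral>\<omega>. ?N \<omega> \<partial>P) \<le> \<sigma>\<^sup>2 * (\<tau> / ((2 - \<alpha>) * \<alpha>) - 1)" .
qed

end

section \<open>Convergence\<close>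

theorem theorem1:
  fixes m \<tau> K :: nat and \<alpha> \<gamma> L \<sigma> \<kappa> :: real
    and D :: "nat \<Rightarrow> 'b measure"
    and loss :: "'a::euclidean_space \<Rightarrow> 'b \<Rightarrow> real"
    and gradF :: "nat \<Rightarrow> 'a \<Rightarrow> 'a"
    and g :: "nat \<Rightarrow> 'a \<Rightarrow> 'b \<Rightarrow> 'a"
    and P :: "'w measure"
    and \<xi> :: "nat \<Rightarrow> nat \<Rightarrow> 'w \<Rightarrow> 'b"
    and x0 :: 'a
  assumes m_pos: "m \<ge> 1"
    and D_prob: "\<forall>i<m. prob_space (D i)"
    and loss_int: "\<forall>i<m. \<forall>x. integrable (D i) (loss x)"
    and grad: "\<forall>i<m. \<forall>x. (F_loc (D i) loss has_derivative (\<lambda>h. gradF i x \<bullet> h)) (at x)"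
    and bdd: "bdd_below (range (F_glob m D loss))"
    and smooth: "\<forall>i<m. \<forall>x y. norm (gradF i x - gradF i y) \<le> L * norm (x - y)"
    and g_meas: "\<forall>i<m. (\<lambda>(x, s). g i x s) \<in> borel_measurable (borel \<Otimes>\<^sub>M D i)"
    and unbiased: "\<forall>i<m. \<forall>x. integrable (D i) (g i x) \<and> (\<integral>s. g i x s \<partial>D i) = gradF i x"
    and var: "\<forall>i<m. \<forall>x. integrable (D i) (\<lambda>s. (norm (g i x s - gradF i x))\<^sup>2)
                 \<and> (\<integral>s. (norm (g i x s - gradF i x))\<^sup>2 \<partial>D i) \<le> \<sigma>\<^sup>2"
    and het: "\<forall>x. (\<Sum>i<m. (norm (gradF i x - gradF_glob m gradF x))\<^sup>2) / real m \<le> \<kappa>\<^sup>2"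
    and tau: "\<tau> \<ge> 1"
    and alpha: "0 < \<alpha>" "\<alpha> < 1"
    and gamma_pos: "\<gamma> > 0"
    and gamma: "\<gamma> = (1 / L) * sqrt (real m / real K)"
    and K_large: "real K \<ge> 60 * real m * (real \<tau>)\<^sup>2 / \<alpha>\<^sup>2"
    and P_prob: "prob_space P"
    and indep: "prob_space.indep_vars P (\<lambda>(k, i). D i) (\<lambda>(k, i). \<xi> k i) (UNIV \<times> {..<m})"
    and distr: "\<forall>k. \<forall>i<m. distr P (D i) (\<xi> k i) = D i"
  shows "(\<Sum>k<K. (\<integral>\<omega>. (norm (gradF_glob m gradF
              (ols_y m \<tau> \<alpha> \<gamma> g x0 (\<lambda>k i. \<xi> k i \<omega>) k)))\<^sup>2 \<partial>P)) / real K
     \<le> 4 * L * (F_glob m D loss x0 - Inf (range (F_glob m D loss)))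
          / ((1 - \<alpha>) * sqrt (real m * real K))
       + 2 * (1 - \<alpha>) * \<sigma>\<^sup>2 / sqrt (real m * real K)
       + 2 * real m * \<sigma>\<^sup>2 / real K * (2 / ((2 - \<alpha>) * \<alpha>) * real \<tau> - 1)
       + 2 * real m * (real \<tau>)\<^sup>2 * \<kappa>\<^sup>2 / (\<alpha>\<^sup>2 * real K)"
proof -
  have K: "0 < real K"
  proof -
    have "0 < 60 * real m * (real \<tau>)\<^sup>2 / \<alpha>\<^sup>2" using m_pos tau alpha by simp
    with K_large show ?thesis by linarith
  qed
  \<comment> \<open>The sign of \<open>L\<close> follows from \<open>gamma\<close>, as both
    \<open>\<gamma>\<close> and the square root are positive.\<close>
  have L: "0 < L"
    using gamma_pos K m_pos unfolding gamma by (simp add: zero_less_mult_iff zero_less_divide_iff divide_less_0_iff)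
  have \<gamma>L: "\<gamma> * L = sqrt (real m / real K)" using L by (simp add: gamma)
  have \<gamma>L2: "(\<gamma> * L)\<^sup>2 = real m / real K" unfolding \<gamma>L by simp
  \<comment> \<open>Since \<open>(\<gamma> * L)\<^sup>2 = real m / real K\<close>, this is the lower
    bound on \<open>K\<close> in another form.\<close>
  have step: "60 * (\<gamma> * L * \<tau>)\<^sup>2 \<le> \<alpha>\<^sup>2"
    using K_large K alpha unfolding power_mult_distrib[of "\<gamma> * L"] \<gamma>L2 by (simp add: field_simps)
  interpret prob_space P by (rule P_prob)
  interpret overlap_sgd P m \<tau> \<alpha> \<gamma> L \<sigma> D gradF g \<xi> x0
  proof (intro overlap_sgd.intro overlap_sgd_axioms.intro)
    show "prob_space P" by (rule P_prob)
    show "1 \<le> m" by (rule m_pos)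
    show "indep_vars (\<lambda>(k, i). D i) (\<lambda>(k, i). \<xi> k i) (UNIV \<times> {..<m})" by (rule indep)
    fix i k and x y :: 'a
    assume i: "i < m"
    show "prob_space (D i)" using D_prob i by blast
    show "norm (gradF i x - gradF i y) \<le> L * norm (x - y)" using smooth i by blast
    show "(\<lambda>(x, s). g i x s) \<in> borel_measurable (borel \<Otimes>\<^sub>M D i)" using g_meas i by blast
    show "integrable (D i) (g i x)" "(\<integral>s. g i x s \<partial>D i) = gradF i x" using unbiased i by blast+
    show "integrable (D i) (\<lambda>s. (norm (g i x s - gradF i x))\<^sup>2)"
      "(\<integral>s. (norm (g i x s - gradF i x))\<^sup>2 \<partial>D i) \<le> \<sigma>\<^sup>2" using var i by blast+
    show "distr P (D i) (\<xi> k i) = D i" using distr i by blast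
  qed
  define f where "f = F_glob m D loss"
  define c where "c = Inf (range f)"
  define \<eta> where "\<eta> = (1 - \<alpha>) * \<gamma>"
  define y where "y = (\<lambda>\<omega>. ols_y m \<tau> \<alpha> \<gamma> g x0 (\<lambda>k i. \<xi> k i \<omega>))"
  define s where "s = (\<lambda>\<omega> k. mean m (\<lambda>i. gradF i (X \<omega> k i)))"
  define \<nu> where "\<nu> = (\<lambda>\<omega> k. mean m (noise \<omega> k))"
  define N where "N = (\<lambda>\<omega> n. mean m (\<lambda>i. (norm (damped \<tau> (1 - \<alpha>) (\<lambda>k. noise \<omega> k i - mean m (noise \<omega> k)) n))\<^sup>2)
        + \<alpha>\<^sup>2 * (norm (damped \<tau> 0 (\<lambda>k. mean m (noise \<omega> k)) n))\<^sup>2)"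
  have \<eta>: "0 < \<eta>" using alpha gamma_pos by (simp add: \<eta>_def)
  have glob: "gradF_glob m gradF x = mean m (\<lambda>i. gradF i x)" for x
    by (simp add: gradF_glob_def mean_def)
  have der: "(f has_derivative (\<lambda>h. gradF_glob m gradF x \<bullet> h)) (at x)" for x
  proof -
    have "((\<lambda>x. \<Sum>i<m. F_loc (D i) loss x) has_derivative (\<lambda>h. \<Sum>i<m. gradF i x \<bullet> h)) (at x)"
      using grad by (intro has_derivative_sum) auto
    then have "((\<lambda>x. (1 / real m) *\<^sub>R (\<Sum>i<m. F_loc (D i) loss x)) has_derivative
        (\<lambda>h. (1 / real m) *\<^sub>R (\<Sum>i<m. gradF i x \<bullet> h))) (at x)"
      by (rule has_derivative_scaleR_right)
    moreover have "(\<lambda>x. (1 / real m) *\<^sub>R (\<Sum>i<m. F_loc (D i) loss x)) = f"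
      by (simp add: f_def F_glob_def fun_eq_iff)
    ultimately show ?thesis
      by (simp add: gradF_glob_def inner_sum_left)
  qed
  have lower: "c \<le> f x" for x
    unfolding c_def using bdd by (intro cInf_lower) (auto simp: f_def)
  have pathwise: "\<eta> / 2 * (\<Sum>k<K. (norm (gradF_glob m gradF (y \<omega> k)))\<^sup>2)
    \<le> f x0 - c + \<eta> / 2 * ((\<gamma> * L)\<^sup>2 * (210 / 53 * (\<Sum>k<K. N \<omega> k) + 105 / 53 * \<kappa>\<^sup>2 * (\<tau> / \<alpha>)\<^sup>2 * K))
      + (\<Sum>k<K. L * \<eta>\<^sup>2 / 2 * (norm (\<nu> \<omega> k))\<^sup>2 + L * \<eta>\<^sup>2 * (s \<omega> k \<bullet> \<nu> \<omega> k)
          - \<eta> * (gradF_glob m gradF (y \<omega> k) \<bullet> \<nu> \<omega> k))" for \<omega>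
    unfolding \<eta>_def y_def N_def s_def \<nu>_def X_def
  proof (rule ols_gradient_sum)
    show "mean m (\<lambda>i. (norm (gradF i x - gradF_glob m gradF x))\<^sup>2) \<le> \<kappa>\<^sup>2" for x
      using het by (simp add: mean_real)
    show "noise \<omega> k i = g i (fst (ols m \<tau> \<alpha> \<gamma> g x0 (\<lambda>k i. \<xi> k i \<omega>) k) i) (\<xi> k i \<omega>)
        - gradF i (fst (ols m \<tau> \<alpha> \<gamma> g x0 (\<lambda>k i. \<xi> k i \<omega>) k) i)" for k i
      by (simp add: noise_def X_def)
  qed (use m_pos tau alpha gamma_pos L step der lower smooth in auto)
  have y: "y \<omega> k = (1 - \<alpha>) *\<^sub>R mean m (X \<omega> k) + \<alpha> *\<^sub>R z \<omega> k" for \<omega> k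
    unfolding y_def X_def z_def by (rule ols_y_eq)
  have sq_y: "sq_integrable P (\<lambda>\<omega>. y \<omega> k)" for k
    unfolding y using sq_integrable_X_z[of k]
    by (intro sq_integrable_add sq_integrable_scaleR sq_integrable_mean) auto
  have sq_grad: "sq_integrable P (\<lambda>\<omega>. gradF_glob m gradF (y \<omega> k))" for k
    unfolding glob by (intro sq_integrable_mean sq_integrable_gradF sq_y)
  have sq_s: "sq_integrable P (\<lambda>\<omega>. s \<omega> k)" for k
    unfolding s_def using sq_integrable_X_z[of k] by (intro sq_integrable_mean sq_integrable_gradF) auto
  have sq_\<nu>: "sq_integrable P (\<lambda>\<omega>. \<nu> \<omega> k)" for k
    unfolding \<nu>_def by (rule sq_integrable_mean_noise)
  have X_past: "(\<lambda>\<omega>. X \<omega> k i) \<in> borel_measurable (sampled (past k))" if "i < m" for k i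
    using that by (intro X_sampled) auto
  have mean_past: "(\<lambda>\<omega>. mean m (h \<omega>)) \<in> borel_measurable (sampled (past k))"
    if "\<And>i. i < m \<Longrightarrow> (\<lambda>\<omega>. h \<omega> i) \<in> borel_measurable (sampled (past k))" for h :: "'w \<Rightarrow> nat \<Rightarrow> 'a" and k
    unfolding mean_def using that by (intro borel_measurable_scaleR borel_measurable_sum) auto
  have y_past: "(\<lambda>\<omega>. y \<omega> k) \<in> borel_measurable (sampled (past k))" for k
    unfolding y using mean_past[OF X_past] z_sampled[of k "past k"]
    by (intro borel_measurable_add borel_measurable_scaleR) auto
  \<comment> \<open>Both \<open>s\<close> and the gradient at \<open>y\<close> are determined by the
    mini-batches before step \<open>k\<close>, so the terms linear in the mean noise integrate to
    zero.\<close>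
  have orth_s: "(\<integral>\<omega>. s \<omega> k \<bullet> \<nu> \<omega> k \<partial>P) = 0" for k
    unfolding \<nu>_def s_def
    by (intro mean_noise_orthogonal mean_past measurable_compose[OF X_past gradF_measurable]
        sq_s[unfolded s_def])
  have orth_grad: "(\<integral>\<omega>. gradF_glob m gradF (y \<omega> k) \<bullet> \<nu> \<omega> k \<partial>P) = 0" for k
    unfolding \<nu>_def glob
    by (intro mean_noise_orthogonal mean_past measurable_compose[OF y_past gradF_measurable]
        sq_grad[unfolded glob])
  note int = sq_integrable_norm[OF sq_grad] sq_integrable_norm[OF sq_\<nu>]
    sq_integrable_inner[OF sq_s sq_\<nu>] sq_integrable_inner[OF sq_grad sq_\<nu>]
  have N_int: "integrable P (\<lambda>\<omega>. N \<omega> k)"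
    and N_le: "(\<integral>\<omega>. N \<omega> k \<partial>P) \<le> \<sigma>\<^sup>2 * (\<tau> / ((2 - \<alpha>) * \<alpha>) - 1)" for k
    unfolding N_def using damped_noise_square[OF tau alpha] by auto
  define A where "A = (\<Sum>k<K. \<integral>\<omega>. (norm (gradF_glob m gradF (y \<omega> k)))\<^sup>2 \<partial>P)"
  have "\<eta> / 2 * A = (\<integral>\<omega>. \<eta> / 2 * (\<Sum>k<K. (norm (gradF_glob m gradF (y \<omega> k)))\<^sup>2) \<partial>P)"
    unfolding A_def using int by simp
  also have "\<dots> \<le> (\<integral>\<omega>. f x0 - c + \<eta> / 2 * ((\<gamma> * L)\<^sup>2 * (210 / 53 * (\<Sum>k<K. N \<omega> k) + 105 / 53 * \<kappa>\<^sup>2 * (\<tau> / \<alpha>)\<^sup>2 * K))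
      + (\<Sum>k<K. L * \<eta>\<^sup>2 / 2 * (norm (\<nu> \<omega> k))\<^sup>2 + L * \<eta>\<^sup>2 * (s \<omega> k \<bullet> \<nu> \<omega> k)
          - \<eta> * (gradF_glob m gradF (y \<omega> k) \<bullet> \<nu> \<omega> k)) \<partial>P)"
    using int N_int by (intro integral_mono pathwise) auto
  also have "\<dots> = f x0 - c + \<eta> / 2 * ((\<gamma> * L)\<^sup>2 * (210 / 53 * (\<Sum>k<K. \<integral>\<omega>. N \<omega> k \<partial>P) + 105 / 53 * \<kappa>\<^sup>2 * (\<tau> / \<alpha>)\<^sup>2 * K))
      + (\<Sum>k<K. L * \<eta>\<^sup>2 / 2 * (\<integral>\<omega>. (norm (\<nu> \<omega> k))\<^sup>2 \<partial>P))"
    using int N_int by (simp add: orth_s orth_grad prob_space)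
  also have "\<dots> \<le> f x0 - c + \<eta> / 2 * ((\<gamma> * L)\<^sup>2 * (210 / 53 * (\<Sum>k<K. \<sigma>\<^sup>2 * (\<tau> / ((2 - \<alpha>) * \<alpha>) - 1)) + 105 / 53 * \<kappa>\<^sup>2 * (\<tau> / \<alpha>)\<^sup>2 * K))
      + (\<Sum>k<K. L * \<eta>\<^sup>2 / 2 * (\<sigma>\<^sup>2 / m))"
    using \<eta> L mean_noise_square unfolding \<nu>_def
    by (intro add_mono mult_left_mono sum_mono N_le order_refl) auto
  finally have "\<eta> / 2 * A \<le> f x0 - c + \<eta> / 2 * ((\<gamma> * L)\<^sup>2 * (210 / 53 * (K * (\<sigma>\<^sup>2 * (\<tau> / ((2 - \<alpha>) * \<alpha>) - 1))) + 105 / 53 * \<kappa>\<^sup>2 * (\<tau> / \<alpha>)\<^sup>2 * K))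
      + K * (L * \<eta>\<^sup>2 / 2 * (\<sigma>\<^sup>2 / m))" (is "_ \<le> ?T")
    by (simp only: sum_constant card_lessThan)
  then have "\<eta> / 2 * A * (2 / (\<eta> * K)) \<le> ?T * (2 / (\<eta> * K))"
    using \<eta> by (intro mult_right_mono) auto
  moreover have "\<eta> / 2 * A * (2 / (\<eta> * K)) = A / K"
    using \<eta> by simp
  ultimately have "A / K \<le> ?T * (2 / (\<eta> * K))" by linarith
  also have "\<dots> = 2 * (f x0 - c) / (\<eta> * K) + (\<gamma> * L)\<^sup>2 * (210 / 53 * (\<sigma>\<^sup>2 * (\<tau> / ((2 - \<alpha>) * \<alpha>) - 1)) + 105 / 53 * \<kappa>\<^sup>2 * (\<tau> / \<alpha>)\<^sup>2)
      + L * \<eta> * (\<sigma>\<^sup>2 / m)"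
  proof -
    \<comment> \<open>The large subterms become variables, so that the simplifier does not expand
      them.\<close>
    have "(a + \<eta> / 2 * (q * (210 / 53 * (K * b) + d * K)) + K * (L * \<eta>\<^sup>2 / 2 * e)) * (2 / (\<eta> * K))
      = 2 * a / (\<eta> * K) + q * (210 / 53 * b + d) + L * \<eta> * e" for a b d e q :: real
      using \<eta> K by (simp add: field_simps power2_eq_square)
    then show ?thesis .
  qed
  also have "\<dots> \<le> 4 * L * (f x0 - c) / ((1 - \<alpha>) * sqrt (real m * real K))
      + (2 * real m * \<sigma>\<^sup>2 / real K * (2 / ((2 - \<alpha>) * \<alpha>) * real \<tau> - 1)
          + 2 * real m * (real \<tau>)\<^sup>2 * \<kappa>\<^sup>2 / (\<alpha>\<^sup>2 * real K))
      + 2 * (1 - \<alpha>) * \<sigma>\<^sup>2 / sqrt (real m * real K)"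
  proof (intro add_mono)
    \<comment> \<open>All roots are expressed by \<open>r\<close>: as
      \<open>sqrt (m / K) = r / K\<close>, the step size is \<open>r / (L * K)\<close>. The first
      and last summands then meet their bounds with a factor 2 to spare.\<close>
    define r where "r = sqrt (real m * real K)"
    have r: "0 < r" "r\<^sup>2 = real m * real K" using K m_pos by (auto simp: r_def)
    have "sqrt (real m / real K) = r / real K"
      using K by (simp add: r_def real_sqrt_divide real_sqrt_mult field_simps)
    then have \<gamma>r: "\<gamma> = r / (L * real K)" by (simp add: gamma)
    have "2 * (f x0 - c) / (\<eta> * K) = 2 * L * (f x0 - c) / ((1 - \<alpha>) * r)"
      using K L r alpha by (simp add: \<eta>_def \<gamma>r field_simps)
    also have "\<dots> \<le> 4 * L * (f x0 - c) / ((1 - \<alpha>) * r)"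
      using L r alpha lower[of x0] by (intro divide_right_mono mult_right_mono) auto
    finally show "2 * (f x0 - c) / (\<eta> * K) \<le> 4 * L * (f x0 - c) / ((1 - \<alpha>) * sqrt (real m * real K))"
      by (simp add: r_def)
    have "L * \<eta> * (\<sigma>\<^sup>2 / m) = (1 - \<alpha>) * \<sigma>\<^sup>2 / r"
      using K L r m_pos by (simp add: \<eta>_def \<gamma>r field_simps power2_eq_square)
    also have "\<dots> \<le> 2 * (1 - \<alpha>) * \<sigma>\<^sup>2 / r"
      using r alpha by (intro divide_right_mono mult_right_mono) auto
    finally show "L * \<eta> * (\<sigma>\<^sup>2 / m) \<le> 2 * (1 - \<alpha>) * \<sigma>\<^sup>2 / sqrt (real m * real K)"
      by (simp add: r_def)
    \<comment> \<open>The target bracket is \<open>2 * B + 1\<close>, so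
      \<open>210 / 53 * B \<le> 4 * B + 2\<close> has to hold. This needs \<open>B\<close>
      nonnegative, which follows from
      \<open>(2 - \<alpha>) * \<alpha> = 1 - (1 - \<alpha>)\<^sup>2\<close> being at most 1.\<close>
    define B where "B = \<tau> / ((2 - \<alpha>) * \<alpha>) - 1"
    have "0 \<le> B"
    proof -
      have "(2 - \<alpha>) * \<alpha> \<le> 1" using zero_le_power2[of "1 - \<alpha>"] by (simp add: power2_eq_square algebra_simps)
      then have "(2 - \<alpha>) * \<alpha> \<le> \<tau>" using tau by linarith
      then show ?thesis using alpha by (simp add: B_def)
    qed
    then have "210 / 53 * (\<sigma>\<^sup>2 * B) \<le> \<sigma>\<^sup>2 * (4 * B + 2)"
      using mult_left_mono[of "210 / 53 * B" "4 * B + 2" "\<sigma>\<^sup>2"] by (simp add: mult_ac)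
    moreover have "105 / 53 * \<kappa>\<^sup>2 * (\<tau> / \<alpha>)\<^sup>2 \<le> 2 * \<kappa>\<^sup>2 * (\<tau> / \<alpha>)\<^sup>2"
      by (intro mult_right_mono) auto
    ultimately have "(\<gamma> * L)\<^sup>2 * (210 / 53 * (\<sigma>\<^sup>2 * B) + 105 / 53 * \<kappa>\<^sup>2 * (\<tau> / \<alpha>)\<^sup>2)
        \<le> (\<gamma> * L)\<^sup>2 * (\<sigma>\<^sup>2 * (4 * B + 2) + 2 * \<kappa>\<^sup>2 * (\<tau> / \<alpha>)\<^sup>2)"
      by (intro mult_left_mono add_mono) auto
    also have "\<dots> = 2 * real m * \<sigma>\<^sup>2 / real K * (2 * B + 1) + 2 * real m * (real \<tau>)\<^sup>2 * \<kappa>\<^sup>2 / (\<alpha>\<^sup>2 * real K)"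
      unfolding \<gamma>L2 using K alpha by (simp add: field_simps)
    also have "2 * B + 1 = 2 / ((2 - \<alpha>) * \<alpha>) * real \<tau> - 1"
      by (simp add: B_def)
    finally show "(\<gamma> * L)\<^sup>2 * (210 / 53 * (\<sigma>\<^sup>2 * (\<tau> / ((2 - \<alpha>) * \<alpha>) - 1)) + 105 / 53 * \<kappa>\<^sup>2 * (\<tau> / \<alpha>)\<^sup>2)
      \<le> 2 * real m * \<sigma>\<^sup>2 / real K * (2 / ((2 - \<alpha>) * \<alpha>) * real \<tau> - 1)
          + 2 * real m * (real \<tau>)\<^sup>2 * \<kappa>\<^sup>2 / (\<alpha>\<^sup>2 * real K)"
      by (simp only: B_def)
  qed
  finally show ?thesis
    by (simp only: A_def y_def f_def c_def add_ac)
qed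

end
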